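(* Let $N\ge 1$ be an integer and let $\nu>0$ be constant. The EQMOM-derived moment system $$\partial_t M+A(M)\,\partial_xM=\nu S(M),\qquad S(M)=\rho\big(\Delta_0(U,\theta),\dots,\Delta_{2N}(U,\theta)\big)^T-M,$$ satisfies the structural stability condition for $M\in\mathbb{G}=\mathcal{M}(\Omega_W)$.
   Context: Notation. $\Delta_j(u,\vartheta)$ denotes the $j$th moment $\int_{\mathbb R}\xi^j\frac{1}{\sqrt{2\pi\vartheta}}e^{-(\xi-u)^2/(2\vartheta)}d\xi$ of the Gaussian with mean $u$ and variance $\vartheta>0$; it is a polynomial in $u$ and $\vartheta$. EQMOM with $N$ nodes. For $W=(w_1,u_1,\dots,w_N,u_N,\sigma^2)^T\in\mathbb{R}^{2N+1}$ let $\mathcal{M}(W)=(M_0,\dots,M_{2N})^T$ with $M_j=\sum_{i=1}^N w_i\Delta_j(u_i,\sigma^2)$. The domain is $\Omega_W=\Omega_W^{open}\cup\Omega_W^{eq}$, where $\Omega_W^{open}=\{W: w_i>0,\ \sigma^2>0,\ u_i\ne u_j\ \forall i\ne j\}$ and $\Omega_W^{eq}=\{W: w_i>0,\ \sigma^2>0,\ u_1=\dots=u_N\}$. Given $M=(M_0,\dots,M_{2N})^T$, the macroscopic parameters $\rho,U,\theta$ are defined by $M_0=\rho$, $M_1=\rho U$, $M_2=\rho(U^2+\theta)$. The source $\nu S(M)$ comes from the BGK collision model with collision frequency $\nu$. Coefficient matrix. $A(M)$ is the $(2N+1)\times(2N+1)$ matrix whose entries in position $(k,k+1)$ equal $1$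 for $1\le k\le 2N$, whose last row is $(a_0,\dots,a_{2N})$, and whose other entries are zero. For $M\in\mathcal{M}(\Omega_W^{open})$, one solves $\mathcal{M}(W)=M$ for $W\in\Omega_W^{open}$, so that $\bar M_{2N+1}=\sum_{i=1}^Nw_i\Delta_{2N+1}(u_i,\sigma^2)$ is a function of $M$, and $a_j=\partial\bar M_{2N+1}/\partial M_j$. For $M\in\mathcal{M}(\Omega_W^{eq})$, i.e. $M_j=\rho\Delta_j(U,\theta)$ with $\theta=\sigma^2$, the $a_j$ are defined (by continuous extension) through $$u^{2N+1}-a_{2N}u^{2N}-\dots-a_1u-a_0=\sum_{k\ge0}\frac{1}{k!}\Big(-\frac{\sigma^2}{2}\Big)^k\frac{d^{2k}}{du^{2k}}(u-U)^{2N+1}.$$ Structural stability condition. Consider a system $\partial_tM+A(M)\partial_xM=Q(M)$ with $M\in\mathbb{G}\subset\mathbb{R}^n$, equilibrium manifold $\mathcal{E}=\{M\in\mathbb{G}:Q(M)=0\}\neq\emptyset$, and Jacobian $Q_M=\partial Q/\partial M$ (here $n=2N+1$, $Q=\nu S$; the Jacobian is computed from the formula for $S$ in terms of $M$). The condition requires, with an integer $r$ such that $0<r\le n$: (i) there exist an invertible $n\times n$ matrix $P(M)$ and an invertible $r\times r$ matrix $\hat T(M)$ with $P(M)Q_M(M)=\begin{bmatrix}0&0\\0&\hat T(M)\end{bmatrix}P(M)$ for all $M\in\mathcal{E}$; (ii) there exists a symmetric positive definite matrix $A_0(M)$ with $A_0(M)A(M)=A(M)^TA_0(M)$ for all $M\in\mathbb{G}$;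 (iii) with these same $A_0$ and $P$, $A_0(M)Q_M(M)+Q_M(M)^TA_0(M)\le -P(M)^T\begin{bmatrix}0&0\\0&I_r\end{bmatrix}P(M)$ for all $M\in\mathcal{E}$, where $\le$ is the order of symmetric matrices and $I_r$ is the identity of order $r$.
   Formalization: For N = 1 the source S(M) vanishes identically, so Q_M = 0 and condition (i) cannot hold with r > 0; the condition is proved as stated for N ≥ 2, and for N = 1 with r = 0 in place of 0 < r. *)

theory Defs
  imports
    "HOL-Probability.Distributions"
    "HOL-Computational_Algebra.Polynomial"
    "Jordan_Normal_Form.Matrix"
begin

(* The dimension 2N+1 depends on the natural number N, so vectors and matrices are those of
   Jordan_Normal_Form, with indices starting at 0: M $ j is the moment M_j for j = 0, ..., 2N. *)

unbundle no vec_syntax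
no_notation inner (infix "\<bullet>" 70)


section \<open>Real matrices\<close>

definition sym_pos_def :: "nat \<Rightarrow> real mat \<Rightarrow> bool" where
  "sym_pos_def n B \<longleftrightarrow> B \<in> carrier_mat n n \<and> transpose_mat B = B \<and>
     (\<forall>v \<in> carrier_vec n. v \<noteq> 0\<^sub>v n \<longrightarrow> 0 < v \<bullet> (B *\<^sub>v v))"

(* The order of symmetric matrices; the order relation that Jordan_Normal_Form declares on
   matrices is entrywise and hence a different one. *)
definition loewner_le :: "nat \<Rightarrow> real mat \<Rightarrow> real mat \<Rightarrow> bool" where
  "loewner_le n B C \<longleftrightarrow> (\<forall>v \<in> carrier_vec n. v \<bullet> (B *\<^sub>v v) \<le> v \<bullet> (C *\<^sub>v v))"

(* The n x n matrix with lower right r x r block T and all other blocks zero. *)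
definition lower_block :: "nat \<Rightarrow> nat \<Rightarrow> real mat \<Rightarrow> real mat" where
  "lower_block n r T =
     four_block_mat (0\<^sub>m (n - r) (n - r)) (0\<^sub>m (n - r) r) (0\<^sub>m r (n - r)) T"

definition partial_deriv :: "(real vec \<Rightarrow> real) \<Rightarrow> nat \<Rightarrow> real vec \<Rightarrow> real" where
  "partial_deriv f j M = deriv (\<lambda>t. f (update_vec M j t)) (M $ j)"

definition jacobian :: "nat \<Rightarrow> (real vec \<Rightarrow> real vec) \<Rightarrow> real vec \<Rightarrow> real mat" where
  "jacobian n Q M = mat n n (\<lambda>(i, j). partial_deriv (\<lambda>M'. Q M' $ i) j M)"


section \<open>Structural stability condition\<close>

definition equilibria :: "nat \<Rightarrow> real vec set \<Rightarrow> (real vec \<Rightarrow> real vec) \<Rightarrow> real vec set" where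
  "equilibria n G Q = {M \<in> G. Q M = 0\<^sub>v n}"

definition structurally_stable_rank ::
    "nat \<Rightarrow> nat \<Rightarrow> real vec set \<Rightarrow> (real vec \<Rightarrow> real mat) \<Rightarrow> (real vec \<Rightarrow> real vec) \<Rightarrow> bool" where
  "structurally_stable_rank n r G A Q \<longleftrightarrow>
     r \<le> n \<and> equilibria n G Q \<noteq> {} \<and>
     (\<exists>P T A0.
        (\<forall>M \<in> equilibria n G Q.
           P M \<in> carrier_mat n n \<and> invertible_mat (P M) \<and>
           T M \<in> carrier_mat r r \<and> invertible_mat (T M) \<and>
           P M * jacobian n Q M = lower_block n r (T M) * P M) \<and>
        (\<forall>M \<in> G. sym_pos_def n (A0 M) \<and> A0 M * A M = transpose_mat (A M) * A0 M) \<and>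
        (\<forall>M \<in> equilibria n G Q.
           loewner_le n
             (A0 M * jacobian n Q M + transpose_mat (jacobian n Q M) * A0 M)
             (- (transpose_mat (P M) * lower_block n r (1\<^sub>m r) * P M))))"

(* structurally_stable asks for a positive rank r. Rank 0 is the degenerate case in which the
   Jacobian of Q vanishes at the equilibria; it is what occurs for EQMOM with one node, where
   the source is identically zero. *)
definition structurally_stable ::
    "nat \<Rightarrow> real vec set \<Rightarrow> (real vec \<Rightarrow> real mat) \<Rightarrow> (real vec \<Rightarrow> real vec) \<Rightarrow> bool" where
  "structurally_stable n G A Q \<longleftrightarrow> (\<exists>r. 0 < r \<and> structurally_stable_rank n r G A Q)"


section \<open>EQMOM\<close>

(* The second argument is the variance, whereas normal_density takes the standard deviation. *)
definition gauss_moment :: "nat \<Rightarrow> real \<Rightarrow> real \<Rightarrow> real" where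
  "gauss_moment j u \<theta> = (LINT \<xi>|lborel. \<xi> ^ j * normal_density u (sqrt \<theta>) \<xi>)"

(* W = (w_1, u_1, ..., w_N, u_N, sigma^2) is a vector of dimension 2N+1; nodes are numbered
   from 0 below. *)
definition weight :: "real vec \<Rightarrow> nat \<Rightarrow> real" where
  "weight W i = W $ (2 * i)"

definition node :: "real vec \<Rightarrow> nat \<Rightarrow> real" where
  "node W i = W $ (2 * i + 1)"

definition node_var :: "nat \<Rightarrow> real vec \<Rightarrow> real" where
  "node_var N W = W $ (2 * N)"

definition eqmom_moment :: "nat \<Rightarrow> real vec \<Rightarrow> nat \<Rightarrow> real" where
  "eqmom_moment N W j = (\<Sum>i<N. weight W i * gauss_moment j (node W i) (node_var N W))"

definition moment_map :: "nat \<Rightarrow> real vec \<Rightarrow> real vec" where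
  "moment_map N W = vec (2 * N + 1) (eqmom_moment N W)"

definition Omega_open :: "nat \<Rightarrow> real vec set" where
  "Omega_open N = {W \<in> carrier_vec (2 * N + 1).
     (\<forall>i<N. 0 < weight W i) \<and> 0 < node_var N W \<and>
     (\<forall>i<N. \<forall>j<N. i \<noteq> j \<longrightarrow> node W i \<noteq> node W j)}"

definition Omega_eq :: "nat \<Rightarrow> real vec set" where
  "Omega_eq N = {W \<in> carrier_vec (2 * N + 1).
     (\<forall>i<N. 0 < weight W i) \<and> 0 < node_var N W \<and>
     (\<forall>i<N. \<forall>j<N. node W i = node W j)}"

definition Omega :: "nat \<Rightarrow> real vec set" where
  "Omega N = Omega_open N \<union> Omega_eq N"

definition macro_rho :: "real vec \<Rightarrow> real" where
  "macro_rho M = M $ 0"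

definition macro_U :: "real vec \<Rightarrow> real" where
  "macro_U M = M $ 1 / M $ 0"

definition macro_theta :: "real vec \<Rightarrow> real" where
  "macro_theta M = M $ 2 / M $ 0 - (macro_U M)\<^sup>2"

(* M determines W in Omega_open only up to a permutation of the nodes, which does not
   change the moment of order 2N+1. *)
definition closing_moment :: "nat \<Rightarrow> real vec \<Rightarrow> real" where
  "closing_moment N M =
     (THE m. \<exists>W \<in> Omega_open N. moment_map N W = M \<and> m = eqmom_moment N W (2 * N + 1))"

(* The sum over all k is finite: the terms with k > N differentiate a polynomial of degree
   2N+1 at least 2N+2 times. The variance sigma^2 equals macro_theta M at these M. *)
definition eq_char_poly :: "nat \<Rightarrow> real vec \<Rightarrow> real poly" where
  "eq_char_poly N M =
     (\<Sum>k\<le>N. Polynomial.smult (1 / fact k * (- macro_theta M / 2) ^ k)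
                          ((pderiv ^^ (2 * k)) ([:- macro_U M, 1:] ^ (2 * N + 1))))"

(* For N = 1 the sets Omega_open and Omega_eq coincide, and so do the two formulas. For N > 1
   their images under the moment map are disjoint. *)
definition closure_coeff :: "nat \<Rightarrow> real vec \<Rightarrow> nat \<Rightarrow> real" where
  "closure_coeff N M j =
     (if M \<in> moment_map N ` Omega_open N then partial_deriv (closing_moment N) j M
      else - poly.coeff (eq_char_poly N M) j)"

definition coeff_matrix :: "nat \<Rightarrow> real vec \<Rightarrow> real mat" where
  "coeff_matrix N M = mat (2 * N + 1) (2 * N + 1)
     (\<lambda>(i, j). if i = 2 * N then closure_coeff N M j
                else if j = i + 1 then 1 else 0)"

definition bgk_source :: "nat \<Rightarrow> real vec \<Rightarrow> real vec" where
  "bgk_source N M =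
     macro_rho M \<cdot>\<^sub>v vec (2 * N + 1) (\<lambda>j. gauss_moment j (macro_U M) (macro_theta M)) - M"

end

theory Submission
  imports Defs "HOL-Probability.Discrete_Topology" "Jordan_Normal_Form.Determinant"
begin

text \<open>
  A companion matrix such as \<open>coeff_matrix\<close> is multiplication by \<open>x\<close> in disguise: if a row
  vector is read as the coefficient list of a polynomial of degree at most \<open>2N\<close>, then multiplying
  it from the right by \<open>A(M)\<close> is multiplication by \<open>x\<close> modulo the characteristic polynomial \<open>P\<close> of
  \<open>A(M)\<close>. Hence every basis of these polynomials in which multiplication by \<open>x\<close> modulo \<open>P\<close> has a
  symmetric matrix \<open>J\<close> yields a symmetrizer: the matrix \<open>L\<close> of the coefficients of the basis satisfies
  \<open>L A = J L\<close>, so that \<open>A\<^sub>0 = L\<^sup>T L\<close> works (\<open>companion_symmetrizer\<close>). It remains to find such bases.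

  The Gaussians are handled by the heat flow \<open>heat t = exp (t/2 d\<^sup>2/dx\<^sup>2)\<close> on polynomials, whose value at
  \<open>u\<close> is the expectation under the Gaussian of mean \<open>u\<close> and variance \<open>t\<close>. Since \<open>heat\<close> is a group, a
  mixture of variance \<open>s\<close> evaluated at \<open>heat (- s) p\<close> is the discrete measure on the nodes evaluated at
  \<open>p\<close>. The decisive test polynomial is \<open>q\<close>, the product of all \<open>(x - u\<^sub>i)\<^sup>2\<close>. It vanishes on the nodes,
  whereas \<open>heat t q\<close> is strictly positive for \<open>t > 0\<close>.

  Distinct nodes. Testing with \<open>q\<close> shows that the moments of order at most \<open>2N\<close> determine the closing
  moment (\<open>mom_determined\<close>). A polynomial \<open>p\<close> of degree at most \<open>2N\<close> whose mixture expectation is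
  stationary in all parameters has \<open>heat s p\<close> divisible by \<open>q\<close>, hence \<open>heat s p = b q\<close>, and stationarity
  in the variance forces \<open>b = 0\<close> (\<open>dmom_injective\<close>); so the Jacobian of the moment map is invertible,
  the inverse function theorem applies, and the closing moment is differentiable. Its gradient is
  such that the expectation of \<open>P\<close> itself is stationary (\<open>closing_moment_gradient\<close>). Therefore \<open>q\<close> divides
  the monic polynomial \<open>heat s P\<close> of degree \<open>2N + 1\<close>, which then has only real roots, and the backward
  heat flow turns a real-rooted polynomial into one with simple real roots
  (\<open>backward_heat_real_roots\<close>). In the Lagrange basis of the roots of \<open>P\<close>, the matrix \<open>J\<close> is diagonal.

  Equal nodes. Here \<open>P\<close> is the Hermite polynomial of degree \<open>2N + 1\<close> for mean \<open>U\<close> and variance \<open>\<theta>\<close>. In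
  the basis of normalized Hermite polynomials \<open>J\<close> is the Jacobi matrix of the three-term recurrence.
  The same basis diagonalizes the collision term: only the Hermite coefficients of order \<open>0\<close>, \<open>1\<close>, \<open>2\<close> of
  a Maxwellian change to first order with \<open>\<rho>\<close>, \<open>U\<close>, \<open>\<theta>\<close>, so \<open>L\<close> conjugates the Jacobian of \<open>\<nu> S\<close> to the
  diagonal matrix with three entries \<open>0\<close> and \<open>2N - 2\<close> entries \<open>- \<nu>\<close>
  (\<open>hermite_rows_diagonalize_jacobian\<close>). The transformation \<open>sqrt (2 \<nu>) L\<close> therefore brings the
  Jacobian into block form, and the dissipation inequality holds with equality
  (\<open>dissipation_identity\<close>).

  For \<open>N \<ge> 2\<close>, one more test with \<open>q\<close> shows that a mixture with distinct nodes is never an equilibrium, so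
  the two choices of \<open>A\<^sub>0\<close> do not interfere. For \<open>N = 1\<close> every state is an equilibrium and the
  Jacobian of the source vanishes there.
\<close>

unbundle no vec_syntax

section \<open>The heat flow on polynomials\<close>

text \<open>The operator \<open>exp (t/2 d\<^sup>2/dx\<^sup>2)\<close>. The exponential series stops because differentiation is nilpotent on
polynomials of bounded degree; negative \<open>t\<close> is allowed and inverts the flow.\<close>

definition heat :: "real \<Rightarrow> real poly \<Rightarrow> real poly" where
  "heat t p = (\<Sum>k\<le>degree p. Polynomial.smult ((t / 2) ^ k / fact k) ((pderiv ^^ (2 * k)) p))"

lemma higher_pderiv_eq_0: "degree (p :: real poly) < m \<Longrightarrow> (pderiv ^^ m) p = 0"
  by (rule poly_eqI) (simp add: coeff_higher_pderiv coeff_eq_0)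

lemma smult_sum2: "Polynomial.smult (c :: real) (\<Sum>i\<in>A. f i) = (\<Sum>i\<in>A. Polynomial.smult c (f i))"
  by (induction A rule: infinite_finite_induct) (auto simp: smult_add_right)

text \<open>Freedom in the cut-off lets sums for polynomials of different degrees be compared term by term.\<close>

lemma heat_cutoff:
  assumes "degree p < 2 * Suc K"
  shows "heat t p = (\<Sum>k\<le>K. Polynomial.smult ((t / 2) ^ k / fact k) ((pderiv ^^ (2 * k)) p))"
proof -
  let ?f = "\<lambda>k. Polynomial.smult ((t / 2) ^ k / fact k) ((pderiv ^^ (2 * k)) p)"
  have "heat t p = sum ?f {..max K (degree p)}"
    unfolding heat_def
    by (rule sum.mono_neutral_left) (auto intro!: higher_pderiv_eq_0)
  also have "\<dots> = sum ?f {..K}"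
    by (rule sum.mono_neutral_right) (use assms in \<open>auto intro!: higher_pderiv_eq_0\<close>)
  finally show ?thesis .
qed

lemma heat_add: "heat t (p + q) = heat t p + heat t q"
proof -
  let ?K = "max (degree p) (degree q)"
  have "degree (p + q) \<le> ?K" by (rule degree_add_le_max)
  then show ?thesis
    by (simp add: heat_cutoff[of _ ?K] higher_pderiv_add smult_add_right sum.distrib)
qed

lemma heat_smult: "heat t (Polynomial.smult c p) = Polynomial.smult c (heat t p)"
  by (simp add: heat_cutoff[of _ "degree p"] order.strict_trans1[OF degree_smult_le]
      higher_pderiv_smult smult_sum2 mult.commute)

lemma heat_zero [simp]: "heat t 0 = 0"
  by (simp add: heat_def)

lemma heat_sum: "heat t (sum f A) = (\<Sum>i\<in>A. heat t (f i))"
  by (induction A rule: infinite_finite_induct) (auto simp: heat_add)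

lemma heat_const [simp]: "heat t [:c:] = [:c:]"
  by (simp add: heat_def)

lemma heat_one [simp]: "heat t 1 = 1"
  by (simp add: heat_def)

lemma pderiv_smult_sum: "pderiv (\<Sum>k\<in>A. Polynomial.smult (c k) (f k)) = (\<Sum>k\<in>A. Polynomial.smult (c k) (pderiv (f k) :: real poly))"
  using higher_pderiv_sum[of 1 "\<lambda>k. Polynomial.smult (c k) (f k)" A] by (simp add: pderiv_smult)

lemma heat_pderiv: "heat t (pderiv p) = pderiv (heat t p)"
  by (simp add: heat_cutoff[of _ "degree p"] degree_pderiv pderiv_smult_sum funpow_swap1)

text \<open>Leibniz rule; it is the only input for the commutation relation of \<open>heat t\<close> with multiplication by \<open>x\<close>.\<close>

lemma higher_pderiv_X_times:
  "(pderiv ^^ m) (pCons 0 p) = pCons 0 ((pderiv ^^ m) p) + Polynomial.smult (real m) ((pderiv ^^ (m - 1)) p)"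
proof (induction m)
  case (Suc m)
  show ?case
  proof (cases m)
    case 0
    then show ?thesis by (simp add: pderiv_pCons)
  next
    case (Suc l)
    have "2 * pderiv ((pderiv ^^ l) p) = Polynomial.smult 2 (pderiv ((pderiv ^^ l) p))"
      using smult_add_left[of 1 1 "pderiv ((pderiv ^^ l) p)"] by simp
    with Suc Suc.IH show ?thesis
      by (simp add: pderiv_pCons pderiv_add pderiv_smult algebra_simps smult_add_left)
  qed
qed simp

text \<open>The commutator of \<open>d\<^sup>2/dx\<^sup>2\<close> with multiplication by \<open>x\<close> is \<open>2 d/dx\<close>, which commutes with \<open>heat t\<close>; hence
\<open>heat t\<close> conjugates multiplication by \<open>x\<close> to \<open>x + t d/dx\<close>. As \<open>pCons\<close> generates all polynomials, this
identity drives the inductions below.\<close>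

lemma heat_pCons_0: "heat t (pCons 0 p) = pCons 0 (heat t p) + Polynomial.smult t (pderiv (heat t p))"
proof -
  let ?K = "degree p"
  let ?c = "\<lambda>k. (t / 2) ^ k / fact k"
  have d: "degree (pCons 0 p) < 2 * Suc (Suc ?K)" "degree p < 2 * Suc (Suc ?K)" "degree p < 2 * Suc ?K"
    by (auto simp: degree_pCons_eq_if)
  have "heat t (pCons 0 p) = (\<Sum>k\<le>Suc ?K. Polynomial.smult (?c k) (pCons 0 ((pderiv ^^ (2 * k)) p)))
      + (\<Sum>k\<le>Suc ?K. Polynomial.smult (?c k * real (2 * k)) ((pderiv ^^ (2 * k - 1)) p))"
    unfolding heat_cutoff[OF d(1)] higher_pderiv_X_times smult_add_right sum.distrib by (simp add: mult.commute)
  also have "(\<Sum>k\<le>Suc ?K. Polynomial.smult (?c k) (pCons 0 ((pderiv ^^ (2 * k)) p))) = pCons 0 (heat t p)"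
    unfolding heat_cutoff[OF d(2)]
    by (rule poly_eqI) (simp add: coeff_pCons coeff_sum split: nat.splits)
  also have "(\<Sum>k\<le>Suc ?K. Polynomial.smult (?c k * real (2 * k)) ((pderiv ^^ (2 * k - 1)) p))
     = (\<Sum>k\<le>?K. Polynomial.smult (t * ?c k) (pderiv ((pderiv ^^ (2 * k)) p)))"
  proof -
    have c: "?c (Suc k) * real (2 * Suc k) = t * ?c k" for k
      by (simp add: divide_simps del: of_nat_Suc) (simp add: algebra_simps)
    show ?thesis unfolding sum.atMost_Suc_shift c by simp
  qed
  also have "\<dots> = Polynomial.smult t (pderiv (heat t p))"
    unfolding heat_cutoff[OF d(3)] pderiv_smult_sum smult_sum2 by simp
  finally show ?thesis .
qed

lemma heat_linear_factor:
  "heat t ([:- c, 1:] * p) = [:- c, 1:] * heat t p + Polynomial.smult t (pderiv (heat t p))"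
proof -
  have "[:- c, 1:] * p = pCons 0 p + Polynomial.smult (- c) p" for p :: "real poly" by simp
  then show ?thesis by (simp only: heat_add heat_smult heat_pCons_0 ac_simps)
qed

lemma heat_0 [simp]: "heat 0 p = p"
proof (induction p)
  case (pCons a p)
  have "heat 0 (pCons a p) = heat 0 ([:a:] + pCons 0 p)" by simp
  also have "\<dots> = pCons a p" unfolding heat_add heat_pCons_0 pCons.IH by simp
  finally show ?case .
qed simp

lemma heat_heat: "heat s (heat t p) = heat (s + t) p"
proof (induction p)
  case (pCons a p)
  have "heat s (heat t (pCons a p)) = heat s (heat t ([:a:] + pCons 0 p))" by simp
  also have "\<dots> = heat (s + t) ([:a:] + pCons 0 p)"
    unfolding heat_add heat_pCons_0 heat_smult heat_pderiv pCons.IH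
    by (simp add: smult_add_left)
  finally show ?case by simp
qed simp

lemma degree_heat_le: "degree (heat t p) \<le> degree p"
  unfolding heat_def
  by (rule degree_sum_le) (auto intro: order.trans[OF degree_smult_le] simp: degree_higher_pderiv)

lemma degree_heat [simp]: "degree (heat t p) = degree p"
  using degree_heat_le[of t p] degree_heat_le[of "- t" "heat t p"] by (simp add: heat_heat)

lemma coeff_heat_top: "degree p \<le> n \<Longrightarrow> coeff (heat t p) n = coeff p n"
proof (induction p arbitrary: n)
  case (pCons a p)
  have "heat t (pCons a p) = [:a:] + (pCons 0 (heat t p) + Polynomial.smult t (pderiv (heat t p)))"
    using heat_add[of t "[:a:]" "pCons 0 p"] by (simp add: heat_pCons_0)
  then show ?case
    using pCons by (auto simp: coeff_pCons coeff_pderiv coeff_eq_0 split: nat.splits if_splits)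
qed simp

text \<open>The derivative in the variance comes from the heat equation: \<open>d/dt\<close> acts as one half of the second
space derivative.\<close>

lemma has_derivative_poly_heat:
  fixes u \<theta> :: "'a :: real_normed_vector \<Rightarrow> real"
  assumes u: "(u has_derivative u') (at x)" and th: "(\<theta> has_derivative \<theta>') (at x)"
  shows "((\<lambda>x. poly (heat (\<theta> x) p) (u x)) has_derivative
           (\<lambda>h. poly (heat (\<theta> x) (pderiv p)) (u x) * u' h
               + poly (heat (\<theta> x) (pderiv (pderiv p))) (u x) / 2 * \<theta>' h)) (at x)"
proof -
  let ?K = "degree p"
  let ?D = "\<lambda>m y. poly ((pderiv ^^ m) p) y"
  have d: "degree p < 2 * Suc (Suc ?K)" "degree (pderiv p) < 2 * Suc (Suc ?K)" "degree (pderiv (pderiv p)) < 2 * Suc ?K"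
    by (auto simp: degree_pderiv)
  have pd: "((\<lambda>x. poly q (u x)) has_derivative (\<lambda>h. u' h * poly (pderiv q) (u x))) (at x)" for q
    using DERIV_compose_FDERIV[OF poly_DERIV u] by simp
  have summand: "((\<lambda>x. (\<theta> x / 2) ^ k / fact k * ?D (2 * k) (u x)) has_derivative
      (\<lambda>h. (\<theta> x / 2) ^ k / fact k * (u' h * ?D (Suc (2 * k)) (u x))
         + real k * (\<theta>' h / 2) * (\<theta> x / 2) ^ (k - 1) / fact k * ?D (2 * k) (u x))) (at x)" for k
    by (rule derivative_eq_intros th pd refl | simp)+ (simp add: fun_eq_iff field_simps)
  have "((\<lambda>x. \<Sum>k\<le>Suc ?K. (\<theta> x / 2) ^ k / fact k * ?D (2 * k) (u x)) has_derivative
      (\<lambda>h. \<Sum>k\<le>Suc ?K. (\<theta> x / 2) ^ k / fact k * (u' h * ?D (Suc (2 * k)) (u x))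
         + real k * (\<theta>' h / 2) * (\<theta> x / 2) ^ (k - 1) / fact k * ?D (2 * k) (u x))) (at x)"
    by (intro has_derivative_sum summand)
  also have "(\<lambda>x. \<Sum>k\<le>Suc ?K. (\<theta> x / 2) ^ k / fact k * ?D (2 * k) (u x)) = (\<lambda>x. poly (heat (\<theta> x) p) (u x))"
    unfolding heat_cutoff[OF d(1)] by (simp add: poly_sum)
  also have "(\<lambda>h. \<Sum>k\<le>Suc ?K. (\<theta> x / 2) ^ k / fact k * (u' h * ?D (Suc (2 * k)) (u x))
         + real k * (\<theta>' h / 2) * (\<theta> x / 2) ^ (k - 1) / fact k * ?D (2 * k) (u x))
     = (\<lambda>h. poly (heat (\<theta> x) (pderiv p)) (u x) * u' h
               + poly (heat (\<theta> x) (pderiv (pderiv p))) (u x) / 2 * \<theta>' h)"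
  proof
    fix h
    have 1: "(\<Sum>k\<le>Suc ?K. (\<theta> x / 2) ^ k / fact k * (u' h * ?D (Suc (2 * k)) (u x)))
        = poly (heat (\<theta> x) (pderiv p)) (u x) * u' h"
      unfolding heat_cutoff[OF d(2)] poly_sum poly_smult sum_distrib_right
      by (intro sum.cong refl) (simp add: funpow_swap1)
    have 2: "(\<Sum>k\<le>Suc ?K. real k * (\<theta>' h / 2) * (\<theta> x / 2) ^ (k - 1) / fact k * ?D (2 * k) (u x))
        = poly (heat (\<theta> x) (pderiv (pderiv p))) (u x) / 2 * \<theta>' h"
      unfolding heat_cutoff[OF d(3)] poly_sum poly_smult sum_distrib_right sum_divide_distrib sum.atMost_Suc_shift
      by (simp, intro sum.cong refl) (simp add: funpow_swap1 field_simps)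
    show "(\<Sum>k\<le>Suc ?K. (\<theta> x / 2) ^ k / fact k * (u' h * ?D (Suc (2 * k)) (u x))
         + real k * (\<theta>' h / 2) * (\<theta> x / 2) ^ (k - 1) / fact k * ?D (2 * k) (u x))
     = poly (heat (\<theta> x) (pderiv p)) (u x) * u' h
               + poly (heat (\<theta> x) (pderiv (pderiv p))) (u x) / 2 * \<theta>' h"
      unfolding sum.distrib 1 2 ..
  qed
  finally show ?thesis .
qed


section \<open>Gaussian expectations\<close>

text \<open>The commutation relation at the centre \<open>u\<close> reduces the exponent by two and gives the factor
\<open>t (j + 1)\<close>, which is the recursion for the central moments of a Gaussian.\<close>

lemma heat_centred_power:
  "poly (heat t ([:- u, 1:] ^ (2 * k))) u = t ^ k * fact (2 * k) / (2 ^ k * fact k)"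
  "poly (heat t ([:- u, 1:] ^ (2 * k + 1))) u = 0"
proof -
  \<comment> \<open>At the centre the summand with the factor \<open>x - u\<close> drops out of the commutation relation.\<close>
  have step: "poly (heat t ([:- u, 1:] ^ Suc (Suc j))) u = t * real (Suc j) * poly (heat t ([:- u, 1:] ^ j)) u" for j
  proof -
    have "poly (heat t ([:- u, 1:] ^ Suc (Suc j))) u = t * poly (pderiv (heat t ([:- u, 1:] ^ Suc j))) u"
      unfolding power_Suc[of _ "Suc j"] heat_linear_factor by simp
    also have "pderiv (heat t ([:- u, 1:] ^ Suc j)) = Polynomial.smult (real (Suc j)) (heat t ([:- u, 1:] ^ j))"
      unfolding heat_pderiv[symmetric] pderiv_power_Suc by (simp add: heat_smult pderiv_pCons)
    finally show ?thesis by simp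
  qed
  show "poly (heat t ([:- u, 1:] ^ (2 * k))) u = t ^ k * fact (2 * k) / (2 ^ k * fact k)"
  proof (induction k)
    case (Suc k)
    have "poly (heat t ([:- u, 1:] ^ (2 * Suc k))) u = t * real (Suc (2 * k)) * (t ^ k * fact (2 * k) / (2 ^ k * fact k))"
      using step[of "2 * k"] Suc.IH by simp
    also have "\<dots> = t ^ Suc k * fact (2 * Suc k) / (2 ^ Suc k * fact (Suc k))"
      by (simp add: divide_simps)
    finally show ?case .
  qed simp
  show "poly (heat t ([:- u, 1:] ^ (2 * k + 1))) u = 0"
  proof (induction k)
    case 0
    have "heat t ([:- u, 1:] * 1) = [:- u, 1:]" unfolding heat_linear_factor by simp
    then show ?case by simp
  next
    case (Suc k)
    then show ?case using step[of "2 * k + 1"] by simp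
  qed
qed

text \<open>Both sides are linear in \<open>p\<close> and agree on the powers of \<open>x - u\<close> by the known central moments.\<close>

lemma has_bochner_integral_poly_normal_density:
  assumes "0 < t"
  shows "has_bochner_integral lborel (\<lambda>\<xi>. poly p \<xi> * normal_density u (sqrt t) \<xi>) (poly (heat t p) u)"
proof -
  let ?I = "\<lambda>p. has_bochner_integral lborel (\<lambda>\<xi>. poly p \<xi> * normal_density u (sqrt t) \<xi>) (poly (heat t p) u)"
  have add: "?I (p + q)" if "?I p" "?I q" for p q
    using has_bochner_integral_add[OF that] by (simp add: heat_add algebra_simps)
  have smult: "?I (Polynomial.smult c p)" if "?I p" for c p
    using has_bochner_integral_mult_right[OF that, of c] by (simp add: heat_smult algebra_simps)
  have base: "?I ([:- u, 1:] ^ j)" for j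
  proof (cases "even j")
    case True
    then obtain k where "j = 2 * k" by (elim evenE)
    then show ?thesis
      using normal_moment_even[of "sqrt t" u k] assms heat_centred_power(1)[of t u k]
      by (simp add: mult.commute power_divide)
  next
    case False
    then obtain k where "j = 2 * k + 1" by (elim oddE)
    show ?thesis
      using normal_moment_odd[of "sqrt t" u k] assms
      unfolding \<open>j = 2 * k + 1\<close> heat_centred_power(2) by (simp add: mult_ac del: mult_pCons_left mult_pCons_right)
  qed
  have "?I ([:- u, 1:] ^ j * p)" for j
  proof (induction p arbitrary: j)
    case 0
    then show ?case by (simp add: has_bochner_integral_zero)
  next
    case (pCons a p)
    have "[:- u, 1:] ^ j * pCons a p =
        Polynomial.smult a ([:- u, 1:] ^ j) + ([:- u, 1:] ^ Suc j * p + Polynomial.smult u ([:- u, 1:] ^ j * p))"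
    proof -
      have "pCons a p = [:a:] + ([:- u, 1:] * p + Polynomial.smult u p)" by simp
      moreover have "q * [:a:] = Polynomial.smult a q" for q :: "real poly" by simp
      ultimately show ?thesis
        by (simp only: distrib_left mult_smult_right power_Suc) (simp only: mult_ac)
    qed
    then show ?case
      using add[OF smult[OF base] add[OF pCons.IH[of "Suc j"] smult[OF pCons.IH[of j]]]] by simp
  qed
  from this[of 0] show ?thesis by simp
qed

lemma gauss_moment_eq: "0 < t \<Longrightarrow> gauss_moment j u t = poly (heat t (monom 1 j)) u"
  unfolding gauss_moment_def
  using has_bochner_integral_integral_eq[OF has_bochner_integral_poly_normal_density[of t "monom 1 j" u]]
  by (simp add: poly_monom)

text \<open>A nonnegative polynomial that is not zero has only finitely many zeros, so its Gaussian
expectation is positive.\<close>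

lemma heat_pos:
  assumes "0 < t" and nn: "\<And>x. 0 \<le> poly q x" and "q \<noteq> 0"
  shows "0 < poly (heat t q) u"
proof -
  let ?f = "\<lambda>\<xi>. poly q \<xi> * normal_density u (sqrt t) \<xi>"
  have I: "has_bochner_integral lborel ?f (poly (heat t q) u)"
    by (rule has_bochner_integral_poly_normal_density[OF \<open>0 < t\<close>])
  then have eq: "poly (heat t q) u = integral\<^sup>L lborel ?f" and int: "integrable lborel ?f"
    by (auto simp: has_bochner_integral_iff)
  have ge: "0 \<le> integral\<^sup>L lborel ?f"
    by (rule Bochner_Integration.integral_nonneg) (simp add: nn)
  have "integral\<^sup>L lborel ?f \<noteq> 0"
  proof
    assume "integral\<^sup>L lborel ?f = 0"
    then have "AE x in lborel. ?f x = 0"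
      using integral_nonneg_eq_0_iff_AE[OF int] nn by simp
    moreover have "normal_density u (sqrt t) x \<noteq> 0" for x
      using normal_density_pos[of "sqrt t" u x] \<open>0 < t\<close> by simp
    ultimately have "AE x in lborel. poly q x = 0" by simp
    moreover have "AE x in lborel. x \<notin> {x. poly q x = 0}"
      by (rule AE_not_in) (simp add: finite_imp_null_set_lborel poly_roots_finite \<open>q \<noteq> 0\<close>)
    ultimately have "AE x::real in lborel. False" by eventually_elim simp
    then show False by (simp add: AE_iff_null null_sets_def)
  qed
  with ge eq show ?thesis by simp
qed

lemma sum_coeff_heat_monom:
  assumes "degree p < n"
  shows "(\<Sum>j<n. coeff p j * poly (heat t (monom 1 j)) u) = poly (heat t p) u"
proof -
  have "p = (\<Sum>j<n. Polynomial.smult (coeff p j) (monom 1 j))"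
    using assms by (intro poly_eqI) (auto simp: coeff_sum coeff_eq_0 if_distrib cong: if_cong)
  then have "heat t p = (\<Sum>j<n. Polynomial.smult (coeff p j) (heat t (monom 1 j)))"
    by (metis (no_types, lifting) heat_smult heat_sum sum.cong)
  then show ?thesis by (simp add: poly_sum)
qed


section \<open>The backward heat flow separates real roots\<close>

definition monic_roots :: "nat \<Rightarrow> (nat \<Rightarrow> real) \<Rightarrow> real poly" where
  "monic_roots n r = (\<Prod>i<n. [:- r i, 1:])"

lemma poly_monic_roots: "poly (monic_roots n r) x = (\<Prod>i<n. x - r i)"
  by (simp add: monic_roots_def poly_prod)

lemma degree_monic_roots [simp]: "degree (monic_roots n r) = n"
  by (simp add: monic_roots_def degree_prod_eq_sum_degree)

lemma lead_coeff_monic_roots [simp]: "coeff (monic_roots n r) n = 1"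
  using lead_coeff_prod[of "\<lambda>i. [:- r i, 1:]" "{..<n}"] degree_monic_roots[of n r]
  by (simp add: monic_roots_def)

lemma monic_roots_nz [simp]: "monic_roots n r \<noteq> 0"
  by (metis lead_coeff_monic_roots coeff_0 zero_neq_one)

lemma monic_roots_Suc: "monic_roots (Suc n) r = [:- r n, 1:] * monic_roots n r"
  by (simp add: monic_roots_def mult.commute)

text \<open>The difference has degree below \<open>n\<close> and \<open>n\<close> distinct roots.\<close>

lemma monic_eq_monic_roots:
  assumes "degree p = n" "coeff p n = 1" "strict_mono_on {..<n} r" "\<And>i. i < n \<Longrightarrow> poly p (r i) = 0"
  shows "p = monic_roots n r"
proof (rule ccontr)
  let ?d = "p - monic_roots n r"
  assume "p \<noteq> monic_roots n r"
  then have nz: "?d \<noteq> 0" by simp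
  have inj: "inj_on r {..<n}" by (rule strict_mono_on_imp_inj_on[OF assms(3)])
  have "r ` {..<n} \<subseteq> {x. poly ?d x = 0}"
    using assms(4) by (auto simp: poly_monic_roots)
  then have "card (r ` {..<n}) \<le> card {x. poly ?d x = 0}"
    by (intro card_mono poly_roots_finite[OF nz])
  then have le: "n \<le> card {x. poly ?d x = 0}" using card_image[OF inj] by simp
  also have "\<dots> \<le> degree ?d" by (rule card_poly_roots_bound[OF nz])
  finally have "n \<le> degree ?d" .
  moreover have "degree ?d \<le> n" using degree_diff_le[of p n "monic_roots n r"] assms(1) by simp
  ultimately have "degree ?d = n" by simp
  then have "coeff ?d n \<noteq> 0" using nz by (metis leading_coeff_neq_0)
  then show False using assms(2) by simp
qed

text \<open>At simple roots in increasing order the derivative alternates in sign, since exactly \<open>n - 1 - k\<close> of the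
factors \<open>r k - r i\<close> are negative.\<close>

lemma pderiv_monic_roots_sign:
  assumes "strict_mono_on {..<n} r" "k < n"
  shows "0 < (- 1) ^ (n - 1 - k) * poly (pderiv (monic_roots n r)) (r k)"
proof -
  have split: "{..<n} = insert k ({..<k} \<union> {k<..<n})" using assms(2) by auto
  have "monic_roots n r = [:- r k, 1:] * (\<Prod>i\<in>{..<k} \<union> {k<..<n}. [:- r i, 1:])"
    unfolding monic_roots_def by (subst split, subst prod.insert) auto
  then have "poly (pderiv (monic_roots n r)) (r k) = (\<Prod>i\<in>{..<k} \<union> {k<..<n}. r k - r i)"
    by (simp add: pderiv_mult poly_prod pderiv_pCons del: mult_pCons_left mult_pCons_right)
  also have "\<dots> = (\<Prod>i<k. r k - r i) * (\<Prod>i\<in>{k<..<n}. r k - r i)"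
    by (rule prod.union_disjoint) auto
  also have "(\<Prod>i\<in>{k<..<n}. r k - r i) = (\<Prod>i\<in>{k<..<n}. - 1 * (r i - r k))"
    by (intro prod.cong) auto
  also have "\<dots> = (- 1) ^ (n - 1 - k) * (\<Prod>i\<in>{k<..<n}. r i - r k)"
    unfolding prod.distrib by simp
  finally have eq: "poly (pderiv (monic_roots n r)) (r k)
     = (\<Prod>i<k. r k - r i) * ((- 1) ^ (n - 1 - k) * (\<Prod>i\<in>{k<..<n}. r i - r k))" .
  have p1: "0 < (\<Prod>i<k. r k - r i)"
    using assms by (intro prod_pos) (auto simp: strict_mono_on_def)
  have p2: "0 < (\<Prod>i\<in>{k<..<n}. r i - r k)"
    using assms by (intro prod_pos) (auto simp: strict_mono_on_def)
  have cancel: "(- 1 :: real) ^ m * (a * ((- 1) ^ m * b)) = a * b" for m a b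
  proof -
    have "(- 1 :: real) ^ m * (- 1) ^ m = 1" by (simp flip: power_mult_distrib)
    then show ?thesis by (metis mult.left_commute mult.assoc mult_1)
  qed
  show ?thesis unfolding eq cancel using p1 p2 by (rule mult_pos_pos)
qed

lemma monic_sign_at_infinity:
  fixes p :: "real poly"
  assumes "degree p = n" "coeff p n = 1"
  shows "\<exists>B. \<forall>x\<ge>B. 0 < poly p x \<and> 0 < (- 1) ^ n * poly p (- x)"
proof -
  have 1: "\<exists>B. \<forall>x\<ge>B. 0 < poly p x" if "0 < lead_coeff p" for p :: "real poly"
    using poly_pinfty_gt_lc[OF that] that by (meson less_le_trans)
  let ?q = "Polynomial.smult ((- 1) ^ n) (pcompose p [:0, - 1:])"
  have "lead_coeff ?q = 1"
    using assms by (simp add: lead_coeff_comp power_mult_distrib[symmetric])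
  then obtain B1 where B1: "\<And>x. x \<ge> B1 \<Longrightarrow> 0 < poly ?q x" using 1[of ?q] by auto
  obtain B2 where B2: "\<And>x. x \<ge> B2 \<Longrightarrow> 0 < poly p x" using 1[of p] assms by auto
  show ?thesis
    by (rule exI[of _ "max B1 B2"]) (use B1 B2 in \<open>auto simp: poly_pcompose\<close>)
qed

text \<open>At a root \<open>r k\<close> of the old polynomial \<open>h\<close> the new one has the value \<open>- s h'(r k)\<close>, so its signs alternate along
the roots of \<open>h\<close>, and the behaviour at infinity continues the alternation at both ends. This gives
\<open>n + 1\<close> sign changes, hence \<open>n + 1\<close> distinct real roots.\<close>

lemma real_roots_step:
  assumes "strict_mono_on {..<n} r" "0 < s"
  obtains r' where "strict_mono_on {..<Suc n} r'"
    "[:- c, 1:] * monic_roots n r - Polynomial.smult s (pderiv (monic_roots n r)) = monic_roots (Suc n) r'"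
proof -
  let ?h = "monic_roots n r"
  define f where "f = [:- c, 1:] * ?h - Polynomial.smult s (pderiv ?h)"
  have dd: "degree (Polynomial.smult s (pderiv ?h)) < Suc n" by (auto simp: degree_pderiv)
  have h0: "?h \<noteq> 0" using lead_coeff_monic_roots[of n r] by fastforce
  have deg1: "degree ([:- c, 1:] * ?h) = Suc n"
    by (subst degree_mult_eq) (use h0 in auto)
  have deg: "degree f = Suc n"
    unfolding f_def using degree_add_eq_left[of "- Polynomial.smult s (pderiv ?h)" "[:- c, 1:] * ?h"] dd deg1
    by simp
  have lc: "coeff f (Suc n) = 1"
  proof -
    have "coeff ([:- c, 1:] * ?h) (Suc n) = 1"
      using lead_coeff_mult[of "[:- c, 1:]" ?h] deg1 by simp
    then show ?thesis unfolding f_def coeff_diff coeff_eq_0[OF dd] by (simp only: diff_zero)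
  qed
  obtain B where B: "\<And>x. x \<ge> B \<Longrightarrow> 0 < poly f x \<and> 0 < (- 1) ^ Suc n * poly f (- x)"
    using monic_sign_at_infinity[OF deg lc] by blast
  define C where "C = Max (insert B ((\<lambda>i. \<bar>r i\<bar> + 1) ` {..<n}))"
  have CB: "B \<le> C" unfolding C_def by (intro Max_ge) auto
  have Cr: "\<bar>r i\<bar> + 1 \<le> C" if "i < n" for i unfolding C_def using that by (intro Max_ge) auto
  \<comment> \<open>Positive, so that \<open>- C' < C'\<close> also in the case \<open>n = 0\<close>.\<close>
  define C' where "C' = max C 1"
  \<comment> \<open>The \<open>n + 2\<close> points along which the signs alternate.\<close>
  define y where "y k = (if k = 0 then - C' else if k \<le> n then r (k - 1) else C')" for k
  have y_mono: "y k < y (Suc k)" if "k \<le> n" for k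
    using that assms(1) Cr[of "k - 1"] Cr[of k] Cr[of 0]
    by (cases k) (auto simp: y_def C'_def strict_mono_on_def)
  have y_sign: "0 < (- 1) ^ (Suc n - k) * poly f (y k)" if "k \<le> Suc n" for k
  proof -
    have "k = 0 \<or> (1 \<le> k \<and> k \<le> n) \<or> k = Suc n" using that by auto
    then consider "k = 0" | "1 \<le> k" "k \<le> n" | "k = Suc n" by blast
    then show ?thesis
    proof cases
      case 1
      have "C' \<ge> B" using CB by (simp add: C'_def)
      from B[OF this] 1 show ?thesis by (simp add: y_def)
    next
      case 2
      then have yk: "y k = r (k - 1)" by (simp add: y_def)
      have "poly ?h (r (k - 1)) = 0"
        unfolding poly_monic_roots by (rule prod_zero) (use 2 in auto)
      then have fk: "poly f (y k) = - s * poly (pderiv ?h) (r (k - 1))"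
        by (simp add: f_def yk)
      have "0 < (- 1) ^ (n - 1 - (k - 1)) * poly (pderiv ?h) (r (k - 1))"
        by (rule pderiv_monic_roots_sign[OF assms(1)]) (use 2 in auto)
      moreover have "Suc n - k = Suc (n - 1 - (k - 1))" using 2 by auto
      ultimately show ?thesis unfolding fk using \<open>0 < s\<close>
        by (simp add: mult.left_commute[of _ s] zero_less_mult_iff mult_less_0_iff)
    next
      case 3
      have "C' \<ge> B" using CB by (simp add: C'_def)
      from B[OF this] 3 show ?thesis by (simp add: y_def)
    qed
  qed
  have "\<exists>x. y k < x \<and> x < y (Suc k) \<and> poly f x = 0" if "k < Suc n" for k
  proof -
    have "Suc n - k = Suc (Suc n - Suc k)" using that by auto
    then have "0 < - ((- 1) ^ (Suc n - Suc k) * poly f (y k))" using y_sign[of k] that by simp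
    moreover have "0 < (- 1) ^ (Suc n - Suc k) * poly f (y (Suc k))" using y_sign[of "Suc k"] that by simp
    ultimately have "0 < - ((- 1) ^ (Suc n - Suc k) * poly f (y k)) * ((- 1) ^ (Suc n - Suc k) * poly f (y (Suc k)))"
      by (rule mult_pos_pos)
    also have "\<dots> = - ((- 1) ^ (Suc n - Suc k) * (- 1) ^ (Suc n - Suc k)) * (poly f (y k) * poly f (y (Suc k)))"
      by (simp only: mult_ac minus_mult_left minus_mult_right) 
    also have "(- 1 :: real) ^ (Suc n - Suc k) * (- 1) ^ (Suc n - Suc k) = 1"
      by (simp flip: power_mult_distrib)
    finally have "poly f (y k) * poly f (y (Suc k)) < 0" by simp
    then show ?thesis using poly_IVT[OF y_mono] that by (metis less_Suc_eq_le)
  qed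
  then obtain r' where r': "\<And>k. k < Suc n \<Longrightarrow> y k < r' k \<and> r' k < y (Suc k) \<and> poly f (r' k) = 0"
    by metis
  have y_le: "y i \<le> y j" if "i \<le> j" "j \<le> Suc n" for i j
    using that
  proof (induction rule: dec_induct)
    case (step m) then show ?case using y_mono[of m] by simp
  qed simp
  have "strict_mono_on {..<Suc n} r'"
  proof (rule strict_mono_onI)
    fix i j assume "i \<in> {..<Suc n}" "j \<in> {..<Suc n}" "i < j"
    then show "r' i < r' j" using r'[of i] r'[of j] y_le[of "Suc i" j] by simp
  qed
  moreover from this have "f = monic_roots (Suc n) r'"
    using r' by (intro monic_eq_monic_roots deg lc) auto
  ultimately show thesis using that unfolding f_def by blast
qed

text \<open>The backward flow turns multiplication by \<open>x - c\<close> into \<open>h \<mapsto> (x - c) h - s h'\<close>. Adding the linear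
factors one at a time, every step keeps the roots real and simple, even where factors coincide.\<close>

lemma backward_heat_real_roots:
  assumes "0 < s"
  obtains r where "strict_mono_on {..<n} r" "heat (- s) (monic_roots n c) = monic_roots n r"
proof -
  have "\<exists>r. strict_mono_on {..<n} r \<and> heat (- s) (monic_roots n c) = monic_roots n r"
  proof (induction n)
    case 0
    show ?case by (rule exI[of _ "\<lambda>_. 0"]) (simp add: monic_roots_def strict_mono_on_def)
  next
    case (Suc n)
    then obtain r where r: "strict_mono_on {..<n} r" "heat (- s) (monic_roots n c) = monic_roots n r" by blast
    have "heat (- s) (monic_roots (Suc n) c)
        = [:- c n, 1:] * monic_roots n r - Polynomial.smult s (pderiv (monic_roots n r))"
      unfolding monic_roots_Suc heat_linear_factor r(2) by simp
    then show ?case using real_roots_step[OF r(1) assms, of "c n"] by metis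
  qed
  then show thesis using that by blast
qed


section \<open>Symmetrizers of companion matrices\<close>

text \<open>Row \<open>k\<close> holds the coefficients of \<open>g k\<close>, so that matrices acting from the right act on polynomials.\<close>

definition rows_mat :: "nat \<Rightarrow> (nat \<Rightarrow> real poly) \<Rightarrow> real mat" where
  "rows_mat n g = mat n n (\<lambda>(k, j). coeff (g k) j)"

lemma rows_mat_carrier [simp]: "rows_mat n g \<in> carrier_mat n n"
  by (simp add: rows_mat_def)

lemma rows_mat_mult_index:
  "B \<in> carrier_mat n n \<Longrightarrow> k < n \<Longrightarrow> j < n \<Longrightarrow> (rows_mat n g * B) $$ (k, j) = (\<Sum>i<n. coeff (g k) i * B $$ (i, j))"
  by (simp add: rows_mat_def scalar_prod_def lessThan_atLeast0)

lemma gram_sym_pos_def: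
  assumes "L \<in> carrier_mat n n" "det L \<noteq> 0"
  shows "sym_pos_def n (transpose_mat L * L)"
  unfolding sym_pos_def_def
proof (intro conjI ballI impI)
  show "transpose_mat L * L \<in> carrier_mat n n" using assms by simp
  show "transpose_mat (transpose_mat L * L) = transpose_mat L * L"
    using assms by (subst transpose_mult) auto
  fix v :: "real vec" assume v: "v \<in> carrier_vec n" "v \<noteq> 0\<^sub>v n"
  have "v \<bullet> (transpose_mat L * L *\<^sub>v v) = (L *\<^sub>v v) \<bullet> (L *\<^sub>v v)"
    using assms(1) v(1) transpose_vec_mult_scalar[of L n n v "L *\<^sub>v v"]
      comm_scalar_prod[of v n "transpose_mat L *\<^sub>v (L *\<^sub>v v)"]
    by (simp add: assoc_mult_mat_vec[of _ n n _ n])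
  moreover have "L *\<^sub>v v \<noteq> 0\<^sub>v n"
    using assms v det_0_iff_vec_prod_zero[OF assms(1)] by blast
  moreover have "L *\<^sub>v v \<in> carrier_vec n" using assms v by simp
  ultimately show "0 < v \<bullet> (transpose_mat L * L *\<^sub>v v)"
    using conjugate_square_greater_0_vec[of "L *\<^sub>v v" n]
    by (simp add: conjugate_real_def) 
qed

text \<open>The hypothesis on \<open>pCons 0 (g k)\<close> says that \<open>J\<close> represents multiplication by \<open>x\<close> modulo \<open>P\<close>. The companion
matrix represents the same operation on coefficients, so \<open>L A = J L\<close> and \<open>L\<^sup>T L A = L\<^sup>T J L\<close> is symmetric.\<close>

lemma companion_symmetrizer:
  fixes A :: "real mat" and a :: "nat \<Rightarrow> real"
  assumes A: "A = mat n n (\<lambda>(i, j). if i = n - 1 then a j else if j = i + 1 then 1 else 0)"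
    and P: "degree P = n" "coeff P n = 1" "\<And>j. j < n \<Longrightarrow> coeff P j = - a j" and n: "0 < n"
    and g: "\<And>k. k < n \<Longrightarrow> degree (g k) < n"
    and J: "\<And>k l. k < n \<Longrightarrow> l < n \<Longrightarrow> J k l = J l k"
    and eq: "\<And>k. k < n \<Longrightarrow> pCons 0 (g k) = (\<Sum>l<n. Polynomial.smult (J k l) (g l)) + Polynomial.smult (\<gamma> k) P"
  shows "transpose_mat (rows_mat n g) * rows_mat n g * A
       = transpose_mat A * (transpose_mat (rows_mat n g) * rows_mat n g)"
proof -
  let ?L = "rows_mat n g"
  let ?J = "mat n n (\<lambda>(k, l). J k l)"
  have L: "?L \<in> carrier_mat n n" by simp
  have Lt: "transpose_mat ?L \<in> carrier_mat n n" by simp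
  have Ac: "A \<in> carrier_mat n n" unfolding A by simp
  have Jc: "?J \<in> carrier_mat n n" by simp
  have Jt: "transpose_mat ?J = ?J" by (rule eq_matI) (auto simp: J)
  have "?L * A = ?J * ?L"
  proof (rule eq_matI)
    fix k j assume "k < dim_row (?J * ?L)" "j < dim_col (?J * ?L)"
    then have k: "k < n" and j: "j < n" by (auto simp: rows_mat_def)
    have "coeff (pCons 0 (g k)) n = coeff (g k) (n - 1)" using n by (cases n) auto
    moreover have "(\<Sum>l<n. J k l * coeff (g l) n) = 0"
      by (intro sum.neutral) (auto simp: coeff_eq_0[OF g])
    ultimately have \<gamma>: "\<gamma> k = coeff (g k) (n - 1)"
      using arg_cong[OF eq[OF k], of "\<lambda>p. coeff p n"] P(2) by (simp add: coeff_sum)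
    have "(?L * A) $$ (k, j) = (\<Sum>i<n. coeff (g k) i * A $$ (i, j))"
      by (rule rows_mat_mult_index[OF Ac k j])
    also have "\<dots> = (\<Sum>i<n. (if i = n - 1 then coeff (g k) i * a j else 0)
        + (if Suc i = j then coeff (g k) i else 0))"
      by (intro sum.cong refl) (use j in \<open>auto simp: A\<close>)
    also have "\<dots> = coeff (g k) (n - 1) * a j + coeff (pCons 0 (g k)) j"
      unfolding sum.distrib using j n by (cases j) auto
    also have "\<dots> = (\<Sum>l<n. J k l * coeff (g l) j)"
      unfolding eq[OF k] using P(3)[OF j] \<gamma> by (simp add: coeff_sum)
    also have "\<dots> = (?J * ?L) $$ (k, j)"
      using k j by (simp add: rows_mat_def scalar_prod_def lessThan_atLeast0)
    finally show "(?L * A) $$ (k, j) = (?J * ?L) $$ (k, j)" .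
  qed (auto simp: A rows_mat_def)
  then have LA: "?L * A = ?J * ?L" .
  have "transpose_mat ?L * ?L * A = transpose_mat ?L * (?J * ?L)"
    unfolding assoc_mult_mat[OF Lt L Ac] LA ..
  also have "\<dots> = transpose_mat ?L * transpose_mat ?J * ?L"
    unfolding Jt by (rule assoc_mult_mat[OF Lt Jc L, symmetric])
  also have "transpose_mat ?L * transpose_mat ?J = transpose_mat (?L * A)"
    unfolding LA by (rule transpose_mult[OF Jc L, symmetric])
  also have "\<dots> = transpose_mat A * transpose_mat ?L"
    by (rule transpose_mult[OF L Ac])
  also have "\<dots> * ?L = transpose_mat A * (transpose_mat ?L * ?L)"
    by (rule assoc_mult_mat[OF _ Lt L]) (use Ac in simp)
  finally show ?thesis .
qed


section \<open>Inverting a map of finitely many coordinates\<close>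

text \<open>The usual contraction argument for \<open>x \<mapsto> x - g' (f x - y)\<close>. It bounds the distance of the
solution from \<open>x0\<close> linearly in the distance of \<open>y\<close> from \<open>f x0\<close>; this continuity at one point is what
the differentiability of the inverse needs.\<close>

lemma local_inverse_banach:
  fixes f :: "'a :: {real_normed_vector, complete_space} \<Rightarrow> 'a"
  assumes der: "\<And>x. (f has_derivative f' x) (at x)"
    and g': "bounded_linear g'" "\<And>h. g' (f' x0 h) = h" "\<And>h. f' x0 (g' h) = h"
    and cont: "\<And>e. 0 < e \<Longrightarrow> \<exists>d>0. \<forall>x. dist x x0 < d \<longrightarrow> onorm (\<lambda>h. f' x h - f' x0 h) \<le> e"
  obtains g where "g (f x0) = x0" "\<forall>\<^sub>F y in nhds (f x0). f (g y) = y" "(g has_derivative g') (at (f x0))"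
proof -
  interpret g': bounded_linear g' by (rule g')
  interpret f0: bounded_linear "f' x0" using der by (rule has_derivative_bounded_linear)
  define B where "B = onorm g'"
  have B0: "0 \<le> B" unfolding B_def by (rule onorm_pos_le[OF g'(1)])
  have B: "norm (g' h) \<le> B * norm h" for h unfolding B_def by (rule onorm[OF g'(1)])
  \<comment> \<open>With this tolerance for the derivative the contraction constant is at most one half.\<close>
  define e where "e = 1 / (2 * (B + 1))"
  have e0: "0 < e" using B0 by (simp add: e_def)
  have Be: "B * e \<le> 1 / 2"
  proof -
    have "B / (2 * (B + 1)) \<le> 1 / 2" by (subst pos_divide_le_eq) (use B0 in auto)
    then show ?thesis by (simp add: e_def)
  qed
  from cont[OF e0] obtain d where d: "0 < d" "\<And>x. dist x x0 < d \<Longrightarrow> onorm (\<lambda>h. f' x h - f' x0 h) \<le> e"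
    by blast
  define r where "r = d / 2"
  have r0: "0 < r" using d by (simp add: r_def)
  let ?S = "cball x0 r"
  have lin: "norm (f x - f z - f' x0 (x - z)) \<le> norm (x - z) * e" if "x \<in> ?S" "z \<in> ?S" for x z
  proof (rule differentiable_bound_linearization[where S = ?S and f' = f' and ?x0.0 = x0])
    fix t :: real assume "t \<in> {0..1}"
    then show "z + t *\<^sub>R (x - z) \<in> ?S"
      using convexD_alt[OF convex_cball that(2,1), of t] by (simp add: algebra_simps)
  next
    fix y assume "y \<in> ?S"
    then show "(f has_derivative f' y) (at y within ?S)" using der has_derivative_at_withinI by blast
    have "dist y x0 < d" using \<open>y \<in> ?S\<close> d(1) by (simp add: r_def dist_commute)
    then show "onorm (f' y - f' x0) \<le> e" using d(2) by (simp add: fun_diff_def)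
  qed (use r0 in auto)
  define \<Phi> where "\<Phi> y x = x - g' (f x - y)" for y x
  have contr: "dist (\<Phi> y x) (\<Phi> y z) \<le> 1 / 2 * dist x z" if "x \<in> ?S" "z \<in> ?S" for x y z
  proof -
    have "\<Phi> y x - \<Phi> y z = - g' (f x - f z - f' x0 (x - z))"
      unfolding \<Phi>_def by (simp add: g'.diff f0.diff g'(2))
    then have "dist (\<Phi> y x) (\<Phi> y z) \<le> B * (norm (x - z) * e)"
      unfolding dist_norm using B[of "f x - f z - f' x0 (x - z)"] mult_left_mono[OF lin[OF that] B0]
      by simp
    also have "\<dots> = (B * e) * norm (x - z)" by simp
    also have "\<dots> \<le> 1 / 2 * norm (x - z)" by (rule mult_right_mono[OF Be]) simp
    finally show ?thesis by (simp add: dist_norm)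
  qed
  define \<delta> where "\<delta> = e * r"
  have \<delta>0: "0 < \<delta>" using r0 e0 by (simp add: \<delta>_def)
  have base: "dist x0 (\<Phi> y x0) \<le> B * dist y (f x0)" for y
    using B[of "f x0 - y"] by (simp add: \<Phi>_def dist_norm norm_minus_commute)
  have ex: "\<exists>x\<in>?S. \<Phi> y x = x" if "dist y (f x0) < \<delta>" for y
  proof -
    have "B * dist y (f x0) \<le> B * \<delta>" using that B0 by (intro mult_left_mono) auto
    also have "\<dots> \<le> r / 2" using mult_right_mono[OF Be, of r] r0 by (simp add: \<delta>_def)
    finally have small: "dist x0 (\<Phi> y x0) \<le> r / 2" using base[of y] by simp
    have "\<exists>!x\<in>?S. \<Phi> y x = x"
    proof (rule Banach_fix[where c = "1 / 2"])
      show "\<Phi> y ` ?S \<subseteq> ?S"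
      proof
        fix z assume "z \<in> \<Phi> y ` ?S"
        then obtain x where x: "x \<in> ?S" "z = \<Phi> y x" by auto
        have "dist x0 z \<le> dist x0 (\<Phi> y x0) + dist (\<Phi> y x0) (\<Phi> y x)"
          unfolding x(2) by (rule dist_triangle)
        also have "dist (\<Phi> y x0) (\<Phi> y x) \<le> 1 / 2 * dist x0 x"
          by (rule contr) (use x r0 in auto)
        finally show "z \<in> ?S" using small x(1) by simp
      qed
    qed (use r0 contr in \<open>auto simp: complete_eq_closed\<close>)
    then show ?thesis by blast
  qed
  define g where "g y = (SOME x. x \<in> ?S \<and> \<Phi> y x = x)" for y
  have g: "g y \<in> ?S \<and> \<Phi> y (g y) = g y" if "dist y (f x0) < \<delta>" for y
    unfolding g_def by (rule someI_ex) (use ex[OF that] in blast)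
  have fg: "f (g y) = y" if "dist y (f x0) < \<delta>" for y
  proof -
    have "g' (f (g y) - y) = 0" using g[OF that] by (simp add: \<Phi>_def)
    then have "f (g y) - y = 0" using g'(3)[of "f (g y) - y"] f0.zero by simp
    then show ?thesis by simp
  qed
  have est: "dist (g y) x0 \<le> 2 * B * dist y (f x0)" if "dist y (f x0) < \<delta>" for y
  proof -
    have "dist (g y) x0 \<le> dist (\<Phi> y (g y)) (\<Phi> y x0) + dist (\<Phi> y x0) x0"
      using g[OF that] dist_triangle[of "g y" x0 "\<Phi> y x0"] by simp
    also have "dist (\<Phi> y (g y)) (\<Phi> y x0) \<le> 1 / 2 * dist (g y) x0"
      by (rule contr) (use g[OF that] r0 in auto)
    finally show ?thesis using base[of y] by (simp add: dist_commute)
  qed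
  have gx0: "g (f x0) = x0" using est[of "f x0"] \<delta>0 by simp
  have "continuous (at (f x0)) g"
    unfolding continuous_at gx0
  proof (rule tendsto_dist_iff[THEN iffD2], rule Lim_null_comparison)
    show "\<forall>\<^sub>F y in at (f x0). norm (dist (g y) x0) \<le> 2 * B * dist y (f x0)"
      using est \<delta>0 unfolding eventually_at by auto
    show "((\<lambda>y. 2 * B * dist y (f x0)) \<longlongrightarrow> 0) (at (f x0))"
      by (rule tendsto_eq_intros | simp)+
  qed
  moreover have "g' \<circ> f' x0 = id" using g'(2) by (simp add: fun_eq_iff)
  ultimately have "(g has_derivative g') (at (f x0))"
    using has_derivative_inverse_basic[of f "f' x0" g "f x0" g' "ball (f x0) \<delta>"] der[of x0] g'(1) fg \<delta>0 gx0
    by (simp add: dist_commute)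
  moreover have "\<forall>\<^sub>F y in nhds (f x0). f (g y) = y"
    unfolding eventually_nhds_metric using fg \<delta>0 by blast
  ultimately show thesis using gx0 that by blast
qed

type_synonym bseq = "nat discrete \<Rightarrow>\<^sub>C real"

text \<open>The number of parameters depends on \<open>N\<close>, and a type cannot. The inverse function theorem is therefore
used in one complete space that contains all parameter spaces: the bounded sequences. The index type
carries the discrete metric, for which every bounded sequence is a bounded continuous function.\<close>

abbreviation coord :: "bseq \<Rightarrow> nat \<Rightarrow> real" where
  "coord x k \<equiv> apply_bcontfun x (discrete k)"

lemma bseq_eqI: "(\<And>k. coord x k = coord y k) \<Longrightarrow> x = y"
  by (rule bcontfun_eqI) (metis of_discrete_inverse)

lemma norm_bseq_le: "(\<And>k. \<bar>coord x k\<bar> \<le> b) \<Longrightarrow> norm x \<le> b"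
  by (rule norm_bound) (metis of_discrete_inverse real_norm_def)

lemma coord_le_norm: "\<bar>coord x k\<bar> \<le> norm x"
  using norm_bounded[of x "discrete k"] by simp

lemma fin_bseq_exists: "\<exists>x. \<forall>k. coord x k = (if k < n then v k else 0)"
proof -
  let ?f = "\<lambda>d. if of_discrete d < n then v (of_discrete d) else 0"
  have "?f \<in> bcontfun"
  proof -
    have "bounded (range ?f)"
      by (rule finite_imp_bounded, rule finite_subset[of _ "insert 0 (v ` {..<n})"]) auto
    moreover have "continuous_on UNIV ?f"
      by (simp add: continuous_on_open_vimage open_discrete)
    ultimately show ?thesis unfolding bcontfun_def by blast
  qed
  then obtain x :: bseq where x: "?f = apply_bcontfun x"
    by (rule bcontfunE)
  show ?thesis by (rule exI[of _ x]) (simp add: x[symmetric] discrete_inverse)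
qed

text \<open>Embeds parameter vectors into the bounded sequences.\<close>

definition fin_bseq :: "nat \<Rightarrow> (nat \<Rightarrow> real) \<Rightarrow> bseq" where
  "fin_bseq n v = (SOME x. \<forall>k. coord x k = (if k < n then v k else 0))"

lemma coord_fin_bseq [simp]: "coord (fin_bseq n v) k = (if k < n then v k else 0)"
  using someI_ex[OF fin_bseq_exists[of n v]] by (simp add: fin_bseq_def)

lemma bounded_linear_coord: "bounded_linear (\<lambda>x. coord x k)"
proof (rule bounded_linear_intro[where K = 1])
  show "norm (coord x k) \<le> norm x * 1" for x
    using coord_le_norm[of x k] by simp
qed (auto simp: plus_bcontfun.rep_eq scaleR_bcontfun.rep_eq)

definition unit_bseq :: "nat \<Rightarrow> bseq" where
  "unit_bseq j = fin_bseq (Suc j) (\<lambda>k. if k = j then 1 else 0)"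

lemma coord_unit_bseq [simp]: "coord (unit_bseq j) k = (if k = j then 1 else 0)"
  by (simp add: unit_bseq_def)

text \<open>Associativity of matrix products, for matrices given as functions on \<open>{..<n}\<close>.\<close>

lemma left_inverse_sum:
  fixes A C :: "nat \<Rightarrow> nat \<Rightarrow> real"
  assumes that: "\<And>j. j < n \<Longrightarrow> (\<Sum>k<n. A i k * C k j) = (if i = j then 1 else 0)" "i < n"
  shows "(\<Sum>k<n. A i k * (\<Sum>l<n. C k l * b l)) = b i"
proof -
  have "(\<Sum>k<n. A i k * (\<Sum>l<n. C k l * b l)) = (\<Sum>l<n. (\<Sum>k<n. A i k * C k l) * b l)"
    unfolding sum_distrib_left sum_distrib_right by (subst sum.swap) (simp add: mult.assoc)
  also have "\<dots> = (\<Sum>l<n. if l = i then b l else 0)"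
    by (intro sum.cong) (auto simp: that)
  finally show ?thesis using that(2) by simp
qed

text \<open>Replacing the first \<open>n\<close> coordinates of \<open>x\<close> by \<open>F 0 x, \<dots>, F (n - 1) x\<close> and keeping all others defines a map of
the sequence space whose derivative at \<open>x0\<close> is inverted by \<open>K\<close> on the first \<open>n\<close> coordinates. The curve is the
image of a coordinate line under the local inverse.\<close>

lemma coordinate_curve:
  fixes F :: "nat \<Rightarrow> bseq \<Rightarrow> real" and D :: "nat \<Rightarrow> nat \<Rightarrow> bseq \<Rightarrow> real"
  assumes der: "\<And>i x. i < n \<Longrightarrow> (F i has_derivative (\<lambda>h. \<Sum>k<n. D i k x * coord h k)) (at x)"
    and cont: "\<And>i k. i < n \<Longrightarrow> k < n \<Longrightarrow> isCont (D i k) x0"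
    and KD: "\<And>i j. i < n \<Longrightarrow> j < n \<Longrightarrow> (\<Sum>k<n. K i k * D k j x0) = (if i = j then 1 else 0)"
    and DK: "\<And>i j. i < n \<Longrightarrow> j < n \<Longrightarrow> (\<Sum>k<n. D i k x0 * K k j) = (if i = j then 1 else 0)"
    and j: "j < n"
  obtains \<gamma> v where "\<gamma> 0 = x0" "(\<gamma> has_derivative (\<lambda>t. t *\<^sub>R v)) (at 0)"
    "\<And>k. k < n \<Longrightarrow> coord v k = K k j"
    "\<forall>\<^sub>F t in nhds 0. \<forall>i<n. F i (\<gamma> t) = F i x0 + (if i = j then t else 0)"
proof -
  let ?c = coord
  define f where "f x = x + (\<Sum>i<n. (F i x - ?c x i) *\<^sub>R unit_bseq i)" for x
  define f' where "f' x h = h + (\<Sum>i<n. ((\<Sum>k<n. D i k x * ?c h k) - ?c h i) *\<^sub>R unit_bseq i)" for x h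
  define g' where "g' h = h + (\<Sum>i<n. ((\<Sum>k<n. K i k * ?c h k) - ?c h i) *\<^sub>R unit_bseq i)" for h
  have coord_sum: "?c (\<Sum>i<n. a i *\<^sub>R unit_bseq i) k = (if k < n then a k else 0)" for a k
  proof -
    have "?c (\<Sum>i<n. a i *\<^sub>R unit_bseq i) k = (\<Sum>i<n. ?c (a i *\<^sub>R unit_bseq i) k)"
      by (rule linear_sum) (use bounded_linear_coord bounded_linear.linear in blast)
    also have "\<dots> = (\<Sum>i<n. if i = k then a i else 0)"
      by (intro sum.cong) (auto simp: scaleR_bcontfun.rep_eq)
    finally show ?thesis by simp
  qed
  have cf: "?c (f x) k = (if k < n then F k x else ?c x k)" for x k
    by (simp add: f_def plus_bcontfun.rep_eq coord_sum)
  have cf': "?c (f' x h) k = (if k < n then \<Sum>l<n. D k l x * ?c h l else ?c h k)" for x h k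
    by (simp add: f'_def plus_bcontfun.rep_eq coord_sum)
  have cg': "?c (g' h) k = (if k < n then \<Sum>l<n. K k l * ?c h l else ?c h k)" for h k
    by (simp add: g'_def plus_bcontfun.rep_eq coord_sum)
  have derf: "(f has_derivative f' x) (at x)" for x
    unfolding f_def f'_def
    by (intro has_derivative_add has_derivative_ident has_derivative_sum has_derivative_scaleR_left
        has_derivative_diff der bounded_linear_imp_has_derivative bounded_linear_coord) simp
  have blg': "bounded_linear g'"
    unfolding g'_def
    by (intro bounded_linear_add bounded_linear_ident bounded_linear_sum bounded_linear_sub
        bounded_linear_scaleR_const bounded_linear_const_mult bounded_linear_coord)
  have KDs: "(\<Sum>k<n. K i k * (\<Sum>l<n. D k l x0 * b l)) = b i"
    and DKs: "(\<Sum>k<n. D i k x0 * (\<Sum>l<n. K k l * b l)) = b i" if "i < n" for i b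
    using left_inverse_sum[where A = K and C = "\<lambda>k j. D k j x0", of n i b] KD
      left_inverse_sum[where A = "\<lambda>k j. D k j x0" and C = K, of n i b] DK that by auto
  have g'f': "g' (f' x0 h) = h" and f'g': "f' x0 (g' h) = h" for h
    by (rule bseq_eqI, simp add: cf' cg' KDs DKs)+
  have small: "\<exists>d>0. \<forall>x. dist x x0 < d \<longrightarrow> onorm (\<lambda>h. f' x h - f' x0 h) \<le> e" if e: "0 < e" for e
  proof -
    define S where "S x = (\<Sum>i<n. \<Sum>k<n. \<bar>D i k x - D i k x0\<bar>)" for x
    have "isCont S x0" unfolding S_def by (intro continuous_intros cont) auto
    moreover have "S x0 = 0" by (simp add: S_def)
    ultimately obtain d where d: "0 < d" "\<And>x. dist x x0 < d \<Longrightarrow> \<bar>S x\<bar> < e"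
      using e unfolding continuous_at_eps_delta dist_real_def by (metis diff_zero)
    have "onorm (\<lambda>h. f' x h - f' x0 h) \<le> e" if "dist x x0 < d" for x
    proof (rule onorm_bound)
      show "0 \<le> e" using e by simp
      fix h
      have "norm (?c (f' x h - f' x0 h) k) \<le> S x * norm h" for k
      proof -
        have "0 \<le> S x" unfolding S_def by (intro sum_nonneg) auto
        show ?thesis
        proof (cases "k < n")
          case True
          have "?c (f' x h - f' x0 h) k = (\<Sum>l<n. (D k l x - D k l x0) * ?c h l)"
            using True by (simp add: minus_bcontfun.rep_eq cf' sum_subtractf left_diff_distrib)
          also have "\<bar>\<dots>\<bar> \<le> (\<Sum>l<n. \<bar>D k l x - D k l x0\<bar> * norm h)"
            using coord_le_norm[of h] by (intro order.trans[OF sum_abs] sum_mono) (auto simp: abs_mult intro!: mult_left_mono)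
          also have "\<dots> = (\<Sum>l<n. \<bar>D k l x - D k l x0\<bar>) * norm h" by (simp add: sum_distrib_right)
          also have "\<dots> \<le> S x * norm h"
            unfolding S_def using True
            by (intro mult_right_mono member_le_sum[of k "{..<n}" "\<lambda>i. \<Sum>l<n. \<bar>D i l x - D i l x0\<bar>"]) (auto intro: sum_nonneg)
          finally show ?thesis by simp
        qed (use \<open>0 \<le> S x\<close> in \<open>simp add: minus_bcontfun.rep_eq cf'\<close>)
      qed
      then have "norm (f' x h - f' x0 h) \<le> S x * norm h" by (intro norm_bseq_le) auto
      also have "\<dots> \<le> e * norm h" using d(2)[OF that] by (intro mult_right_mono) auto
      finally show "norm (f' x h - f' x0 h) \<le> e * norm h" .
    qed
    with d(1) show ?thesis by blast
  qed
  obtain g where g: "g (f x0) = x0" "\<forall>\<^sub>F y in nhds (f x0). f (g y) = y" "(g has_derivative g') (at (f x0))"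
    using local_inverse_banach[of f f' g' x0, OF derf blg' g'f' f'g' small] by blast
  define line where "line t = f x0 + t *\<^sub>R unit_bseq j" for t
  have line: "(line has_derivative (\<lambda>t. t *\<^sub>R unit_bseq j)) (at 0)"
    unfolding line_def by (rule derivative_eq_intros refl | simp)+
  have line0: "line 0 = f x0" by (simp add: line_def)
  have gline: "((\<lambda>t. g (line t)) has_derivative (\<lambda>t. g' (t *\<^sub>R unit_bseq j))) (at 0)"
    using has_derivative_compose[OF line, of g g'] g(3) by (simp add: line0)
  have lin: "g' (t *\<^sub>R unit_bseq j) = t *\<^sub>R g' (unit_bseq j)" for t
    using blg' by (rule linear_simps)
  have "(line \<longlongrightarrow> line 0) (nhds 0)"
    using has_derivative_continuous[OF line] isCont_def tendsto_nhds_iff by blast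
  then have "\<forall>\<^sub>F t in nhds 0. f (g (line t)) = line t"
    using g(2) unfolding line0 by (rule eventually_compose_filterlim[rotated])
  then have ev: "\<forall>\<^sub>F t in nhds 0. \<forall>i<n. F i (g (line t)) = F i x0 + (if i = j then t else 0)"
  proof eventually_elim
    case (elim t)
    show ?case
    proof (intro allI impI)
      fix i assume "i < n"
      then have "F i (g (line t)) = ?c (f (g (line t))) i" by (simp add: cf)
      also have "\<dots> = F i x0 + (if i = j then t else 0)"
        unfolding elim unfolding line_def using \<open>i < n\<close> by (simp add: plus_bcontfun.rep_eq scaleR_bcontfun.rep_eq cf)
      finally show "F i (g (line t)) = F i x0 + (if i = j then t else 0)" .
    qed
  qed
  show thesis
  proof (rule that[of "\<lambda>t. g (line t)" "g' (unit_bseq j)"])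
    show "g (line 0) = x0" by (simp add: line0 g)
    show "((\<lambda>t. g (line t)) has_derivative (\<lambda>t. t *\<^sub>R g' (unit_bseq j))) (at 0)"
      using gline by (simp add: lin)
    show "?c (g' (unit_bseq j)) k = K k j" if "k < n" for k
      using that j by (simp add: cg' if_distrib cong: if_cong)
  qed (rule ev)
qed


section \<open>Moments of Gaussian mixtures\<close>

text \<open>The expectation of \<open>p\<close> under the unnormalized mixture whose parameters \<open>c\<close> are listed in the order
\<open>w\<^sub>1, u\<^sub>1, \<dots>, w\<^sub>N, u\<^sub>N, \<sigma>\<^sup>2\<close>. A plain function \<open>c\<close> serves both for parameter vectors and for bounded sequences.\<close>

definition mom :: "nat \<Rightarrow> (nat \<Rightarrow> real) \<Rightarrow> real poly \<Rightarrow> real" where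
  "mom N c p = (\<Sum>i<N. c (2 * i) * poly (heat (c (2 * N)) p) (c (2 * i + 1)))"

text \<open>The partial derivative of \<open>mom N c p\<close> with respect to \<open>c k\<close>: the variance is the last parameter,
weights sit at even and nodes at odd positions.\<close>

definition dmom :: "nat \<Rightarrow> (nat \<Rightarrow> real) \<Rightarrow> real poly \<Rightarrow> nat \<Rightarrow> real" where
  "dmom N c p k =
    (if k = 2 * N then (\<Sum>i<N. c (2 * i) * poly (heat (c (2 * N)) (pderiv (pderiv p))) (c (2 * i + 1))) / 2
     else if even k then poly (heat (c (2 * N)) p) (c (k + 1))
     else c (k - 1) * poly (heat (c (2 * N)) (pderiv p)) (c k))"

text \<open>With \<open>t\<close> the negative of the variance, the mixture is replaced by the discrete measure on its nodes.\<close>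

lemma mom_heat: "mom N c (heat t p) = (\<Sum>i<N. c (2 * i) * poly (heat (c (2 * N) + t) p) (c (2 * i + 1)))"
  by (simp add: mom_def heat_heat)

lemma mom_add: "mom N c (p + q) = mom N c p + mom N c q"
  by (simp add: mom_def heat_add algebra_simps sum.distrib)

lemma mom_smult: "mom N c (Polynomial.smult a p) = a * mom N c p"
  by (simp add: mom_def heat_smult sum_distrib_left mult_ac)

lemma mom_sum: "mom N c (\<Sum>j\<in>A. Polynomial.smult (a j) (f j)) = (\<Sum>j\<in>A. a j * mom N c (f j))"
  by (induction A rule: infinite_finite_induct) (auto simp: mom_add mom_smult, auto simp: mom_def)

lemma dmom_add: "dmom N c (p + q) k = dmom N c p k + dmom N c q k"
  by (simp add: dmom_def heat_add pderiv_add algebra_simps sum.distrib)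

lemma dmom_smult: "dmom N c (Polynomial.smult a p) k = a * dmom N c p k"
  by (simp add: dmom_def heat_smult pderiv_smult sum_distrib_left mult_ac)

lemma dmom_sum: "dmom N c (\<Sum>j\<in>A. Polynomial.smult (a j) (f j)) k = (\<Sum>j\<in>A. a j * dmom N c (f j) k)"
  by (induction A rule: infinite_finite_induct) (auto simp: dmom_add dmom_smult, auto simp: dmom_def)

lemma poly_as_sum_monom:
  assumes "degree (p :: real poly) < n"
  shows "p = (\<Sum>j<n. Polynomial.smult (coeff p j) (monom 1 j))"
  using assms by (intro poly_eqI) (auto simp: coeff_sum coeff_eq_0 if_distrib cong: if_cong)

lemma coeff_sum_monom:
  "k < n \<Longrightarrow> coeff (\<Sum>j<n. Polynomial.smult (v j) (monom (1 :: real) j)) k = v k"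
  by (simp add: coeff_sum if_distrib cong: if_cong)

lemma sum_pairs:
  fixes f :: "nat \<Rightarrow> real" and N :: nat
  shows "(\<Sum>k<2 * N. f k) = (\<Sum>i<N. f (2 * i) + f (2 * i + 1))"
  by (induction N) auto

lemma has_derivative_mom:
  "((\<lambda>x. mom N (coord x) p) has_derivative
     (\<lambda>h. \<Sum>k<2 * N + 1. dmom N (coord x) p k * coord h k)) (at x)"
proof -
  have c: "((\<lambda>x. coord x k) has_derivative (\<lambda>h. coord h k)) (at x)" for k
    by (rule bounded_linear_imp_has_derivative[OF bounded_linear_coord])
  have "((\<lambda>x. mom N (coord x) p) has_derivative
     (\<lambda>h. \<Sum>i<N. coord x (2 * i) *
          (poly (heat (coord x (2 * N)) (pderiv p)) (coord x (2 * i + 1)) * coord h (2 * i + 1)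
         + poly (heat (coord x (2 * N)) (pderiv (pderiv p))) (coord x (2 * i + 1)) / 2 * coord h (2 * N))
       + coord h (2 * i) * poly (heat (coord x (2 * N)) p) (coord x (2 * i + 1)))) (at x)"
    unfolding mom_def by (intro has_derivative_sum has_derivative_mult c has_derivative_poly_heat)
  moreover have "(\<Sum>i<N. coord x (2 * i) *
          (poly (heat (coord x (2 * N)) (pderiv p)) (coord x (2 * i + 1)) * coord h (2 * i + 1)
         + poly (heat (coord x (2 * N)) (pderiv (pderiv p))) (coord x (2 * i + 1)) / 2 * coord h (2 * N))
       + coord h (2 * i) * poly (heat (coord x (2 * N)) p) (coord x (2 * i + 1)))
     = (\<Sum>k<2 * N + 1. dmom N (coord x) p k * coord h k)" for h
  proof -
    have "(\<Sum>k<2 * N + 1. dmom N (coord x) p k * coord h k) =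
        (\<Sum>k<2 * N. dmom N (coord x) p k * coord h k) + dmom N (coord x) p (2 * N) * coord h (2 * N)"
      by simp
    also have "(\<Sum>k<2 * N. dmom N (coord x) p k * coord h k) =
        (\<Sum>i<N. poly (heat (coord x (2 * N)) p) (coord x (2 * i + 1)) * coord h (2 * i)
         + coord x (2 * i) * poly (heat (coord x (2 * N)) (pderiv p)) (coord x (2 * i + 1)) * coord h (2 * i + 1))"
      unfolding sum_pairs by (intro sum.cong) (auto simp: dmom_def)
    also have "dmom N (coord x) p (2 * N) * coord h (2 * N) = (\<Sum>i<N. coord x (2 * i) *
         (poly (heat (coord x (2 * N)) (pderiv (pderiv p))) (coord x (2 * i + 1)) / 2 * coord h (2 * N)))"
      by (simp add: dmom_def sum_distrib_right sum_divide_distrib mult.assoc)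
    finally show ?thesis by (simp add: sum.distrib algebra_simps)
  qed
  ultimately show ?thesis by simp
qed

lemma isCont_dmom: "isCont (\<lambda>x. dmom N (coord x) p k) x0"
proof -
  have c: "isCont (\<lambda>x. coord x k) x0" for k
    by (rule has_derivative_continuous[OF bounded_linear_imp_has_derivative[OF bounded_linear_coord]])
  have h: "isCont (\<lambda>x. poly (heat (coord x k) q) (coord x l)) x0" for q k l
    by (rule has_derivative_continuous[OF has_derivative_poly_heat])
      (rule bounded_linear_imp_has_derivative[OF bounded_linear_coord])+
  show ?thesis
    unfolding dmom_def by (cases "k = 2 * N"; cases "even k") (auto intro!: continuous_intros c h)
qed

lemma double_roots_dvd:
  assumes "inj_on u {..<N}" "\<And>i. i < N \<Longrightarrow> poly f (u i) = 0" "\<And>i. i < N \<Longrightarrow> poly (pderiv f) (u i) = 0"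
  shows "(monic_roots N u)\<^sup>2 dvd f"
  using assms
proof (induction N)
  case 0
  show ?case by (simp add: monic_roots_def)
next
  case (Suc N)
  have "(monic_roots N u)\<^sup>2 dvd f"
    by (rule Suc.IH) (use Suc.prems in \<open>auto simp: inj_on_def\<close>)
  then obtain l where l: "f = (monic_roots N u)\<^sup>2 * l" by (elim dvdE)
  have ne: "poly (monic_roots N u) (u N) \<noteq> 0"
    unfolding poly_monic_roots using Suc.prems(1) by (fastforce simp: inj_on_def)
  then have "poly l (u N) = 0" using Suc.prems(2)[of N] by (simp add: l)
  then obtain m where m: "l = [:- u N, 1:] * m" by (auto simp: poly_eq_0_iff_dvd elim: dvdE)
  have "pderiv f = (monic_roots N u)\<^sup>2 * pderiv l + l * pderiv ((monic_roots N u)\<^sup>2)"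
    unfolding l by (rule pderiv_mult)
  moreover have "pderiv l = [:- u N, 1:] * pderiv m + m"
    unfolding m pderiv_mult by (simp add: pderiv_pCons)
  ultimately have "poly (pderiv f) (u N) = (poly (monic_roots N u) (u N))\<^sup>2 * poly m (u N)"
    using \<open>poly l (u N) = 0\<close> by simp
  then have "poly m (u N) = 0" using Suc.prems(3)[of N] ne by simp
  then obtain k where k: "m = [:- u N, 1:] * k" by (auto simp: poly_eq_0_iff_dvd elim: dvdE)
  have "f = (monic_roots (Suc N) u)\<^sup>2 * k"
    unfolding l m k monic_roots_Suc power2_eq_square by (simp only: mult_ac)
  then show ?case by simp
qed

text \<open>At a root the second derivative of \<open>r\<^sup>2 (x - u\<^sub>i)\<^sup>2\<close> is \<open>2 r(u\<^sub>i)\<^sup>2\<close>.\<close>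

lemma second_deriv_square:
  assumes "inj_on u {..<N}" "i < N"
  shows "0 < poly (pderiv (pderiv ((monic_roots N u)\<^sup>2))) (u i)"
proof -
  define r where "r = (\<Prod>j\<in>{..<N} - {i}. [:- u j, 1:])"
  have q: "monic_roots N u = [:- u i, 1:] * r"
    unfolding monic_roots_def r_def by (rule prod.remove) (use assms(2) in auto)
  have "poly r (u i) \<noteq> 0"
    using assms by (auto simp: r_def poly_prod inj_on_def)
  moreover have "poly (pderiv (pderiv ((monic_roots N u)\<^sup>2))) (u i) = 2 * (poly r (u i))\<^sup>2"
    unfolding q power2_eq_square
    by (simp add: pderiv_mult pderiv_add pderiv_pCons del: mult_pCons_left mult_pCons_right)
  ultimately show ?thesis by simp
qed

definition open_nodes :: "nat \<Rightarrow> (nat \<Rightarrow> real) \<Rightarrow> bool" where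
  "open_nodes N c \<longleftrightarrow> (\<forall>i<N. 0 < c (2 * i)) \<and> 0 < c (2 * N) \<and> inj_on (\<lambda>i. c (2 * i + 1)) {..<N}"

definition node_poly :: "nat \<Rightarrow> (nat \<Rightarrow> real) \<Rightarrow> real poly" where
  "node_poly N c = monic_roots N (\<lambda>i. c (2 * i + 1))"

lemma node_poly_nz: "node_poly N c \<noteq> 0"
  by (simp add: node_poly_def)

lemma degree_node_poly_sq: "degree ((node_poly N c)\<^sup>2) = 2 * N"
  using node_poly_nz[of N c] by (simp add: degree_power_eq node_poly_def)

lemma poly_node_poly: "i < N \<Longrightarrow> poly (node_poly N c) (c (2 * i + 1)) = 0"
  unfolding node_poly_def poly_monic_roots by (rule prod_zero) auto

text \<open>Stationarity in the weight and in the node says that \<open>heat s p\<close> and its derivative vanish at that node.\<close>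

lemma dmom_zero_dvd:
  assumes "open_nodes N c" "\<And>k. k < 2 * N \<Longrightarrow> dmom N c p k = 0"
  shows "(node_poly N c)\<^sup>2 dvd heat (c (2 * N)) p"
  unfolding node_poly_def
proof (rule double_roots_dvd)
  show "inj_on (\<lambda>i. c (2 * i + 1)) {..<N}" using assms(1) by (simp add: open_nodes_def)
  fix i assume i: "i < N"
  show "poly (heat (c (2 * N)) p) (c (2 * i + 1)) = 0"
    using assms(2)[of "2 * i"] i by (simp add: dmom_def)
  have "2 * i + 1 \<noteq> 2 * N" by presburger
  then show "poly (pderiv (heat (c (2 * N)) p)) (c (2 * i + 1)) = 0"
    using assms(2)[of "2 * i + 1"] i assms(1) by (auto simp: dmom_def heat_pderiv open_nodes_def)
qed

text \<open>By degree \<open>heat s p\<close> is a multiple \<open>b q\<close> of the squared node polynomial. Its second derivatives at the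
nodes are those of \<open>q\<close> times \<open>b\<close>, and the former have weighted sum zero while the latter are positive.\<close>

lemma dmom_injective:
  assumes o: "open_nodes N c" and N: "1 \<le> N" and deg: "degree p \<le> 2 * N" and z: "\<And>k. k < 2 * N + 1 \<Longrightarrow> dmom N c p k = 0"
  shows "p = 0"
proof -
  let ?f = "heat (c (2 * N)) p" and ?q = "(node_poly N c)\<^sup>2"
  have "?q dvd ?f" by (rule dmom_zero_dvd[OF o]) (use z in auto)
  then obtain l where l: "?f = ?q * l" by (elim dvdE)
  have "?f = 0"
  proof (rule ccontr)
    assume nz: "?f \<noteq> 0"
    then have "degree ?f = 2 * N + degree l"
      using l degree_mult_eq[of ?q l] degree_node_poly_sq[of N c] node_poly_nz[of N c] by auto
    then have "degree l = 0" using deg by simp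
    then obtain b where b: "l = [:b:]" by (elim degree_eq_zeroE)
    have f: "?f = Polynomial.smult b ?q" unfolding l b by simp
    have "0 = 2 * dmom N c p (2 * N)" using z[of "2 * N"] by simp
    also have "\<dots> = (\<Sum>i<N. c (2 * i) * poly (pderiv (pderiv ?f)) (c (2 * i + 1)))"
      by (simp add: dmom_def heat_pderiv)
    also have "\<dots> = b * (\<Sum>i<N. c (2 * i) * poly (pderiv (pderiv ?q)) (c (2 * i + 1)))"
      unfolding f pderiv_smult by (simp add: sum_distrib_left mult_ac)
    finally have "b * (\<Sum>i<N. c (2 * i) * poly (pderiv (pderiv ?q)) (c (2 * i + 1))) = 0" by simp
    moreover have "0 < (\<Sum>i<N. c (2 * i) * poly (pderiv (pderiv ?q)) (c (2 * i + 1)))"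
    proof (rule sum_pos)
      fix i assume "i \<in> {..<N}"
      then show "0 < c (2 * i) * poly (pderiv (pderiv ?q)) (c (2 * i + 1))"
        using o second_deriv_square[of "\<lambda>i. c (2 * i + 1)" N i] by (auto simp: open_nodes_def node_poly_def)
    qed (use N in \<open>auto simp: lessThan_empty_iff\<close>)
    ultimately show False using nz f by simp
  qed
  then have "heat (- c (2 * N)) ?f = 0" by simp
  then show ?thesis by (simp add: heat_heat)
qed

text \<open>The squared node polynomial \<open>q\<close> of the mixture with the smaller variance has expectation zero under the
discrete measure of that mixture. If the variances differed, the other mixture would give a positive
value. With equal variances it follows that the nodes of the second mixture are roots of \<open>q\<close>
as well, so both discrete measures see a polynomial only through its remainder modulo \<open>q\<close>, whose degree is
below \<open>2N\<close>.\<close>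

lemma mom_determined_le:
  assumes o: "open_nodes N c" and o': "open_nodes N c'" and N: "1 \<le> N"
    and eq: "\<And>p. degree p \<le> 2 * N \<Longrightarrow> mom N c p = mom N c' p" and le: "c (2 * N) \<le> c' (2 * N)"
  shows "mom N c p = mom N c' p"
proof -
  let ?q = "(node_poly N c)\<^sup>2" and ?s = "c (2 * N)" and ?s' = "c' (2 * N)"
  have q0: "poly ?q (c (2 * i + 1)) = 0" if "i < N" for i
    using poly_node_poly[OF that, of c] by simp
  have "mom N c (heat (- ?s) ?q) = mom N c' (heat (- ?s) ?q)"
    by (rule eq) (simp add: degree_node_poly_sq)
  then have zero: "(\<Sum>i<N. c' (2 * i) * poly (heat (?s' - ?s) ?q) (c' (2 * i + 1))) = 0"
    unfolding mom_heat using q0 by simp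
  have s: "?s = ?s'"
  proof (rule ccontr)
    assume "?s \<noteq> ?s'"
    with le have "0 < ?s' - ?s" by simp
    then have "0 < poly (heat (?s' - ?s) ?q) x" for x
      by (rule heat_pos) (use node_poly_nz[of N c] in auto)
    then have "0 < (\<Sum>i<N. c' (2 * i) * poly (heat (?s' - ?s) ?q) (c' (2 * i + 1)))"
      by (intro sum_pos) (use o' N in \<open>auto simp: open_nodes_def lessThan_empty_iff\<close>)
    then show False using zero by simp
  qed
  have q0': "poly ?q (c' (2 * i + 1)) = 0" if "i < N" for i
  proof -
    have "c' (2 * i) * poly ?q (c' (2 * i + 1)) = 0"
    proof -
      have "(\<Sum>i<N. c' (2 * i) * poly ?q (c' (2 * i + 1))) = 0" using zero s by simp
      moreover have "\<forall>i\<in>{..<N}. 0 \<le> c' (2 * i) * poly ?q (c' (2 * i + 1))"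
        using o' by (auto simp: open_nodes_def)
      ultimately show ?thesis using that by (subst (asm) sum_nonneg_eq_0_iff) auto
    qed
    then show ?thesis using o' that by (auto simp: open_nodes_def)
  qed
  let ?f = "heat ?s p"
  let ?r = "?f mod ?q"
  have "?q \<noteq> 0" using node_poly_nz[of N c] by simp
  then have "degree ?r \<le> 2 * N"
    using degree_mod_less[of ?q ?f] degree_node_poly_sq[of N c] by auto
  have fr: "poly ?f x = poly ?r x" if "poly ?q x = 0" for x
  proof -
    have "poly ?f x = poly (?f div ?q * ?q + ?r) x" by (simp only: div_mult_mod_eq)
    also have "\<dots> = poly ?r x" using that by (simp del: div_mult_mod_eq)
    finally show ?thesis .
  qed
  have "mom N c p = mom N c (heat (- ?s) ?r)"
    unfolding mom_heat unfolding mom_def using fr q0 by simp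
  also have "\<dots> = mom N c' (heat (- ?s) ?r)"
    by (rule eq) (use \<open>degree ?r \<le> 2 * N\<close> in simp)
  also have "\<dots> = mom N c' p"
    unfolding mom_heat unfolding mom_def using fr q0' s by simp
  finally show ?thesis .
qed

lemma mom_determined:
  assumes "open_nodes N c" "open_nodes N c'" "1 \<le> N"
    and "\<And>j. j < 2 * N + 1 \<Longrightarrow> mom N c (monom 1 j) = mom N c' (monom 1 j)"
  shows "mom N c p = mom N c' p"
proof -
  have eq: "mom N c p = mom N c' p" if "degree p \<le> 2 * N" for p
  proof -
    have d: "degree p < 2 * N + 1" using that by simp
    show ?thesis
      by (subst (1 2) poly_as_sum_monom[OF d], unfold mom_sum) (simp add: assms(4))
  qed
  show ?thesis
    using mom_determined_le[OF assms(1,2,3), of p] mom_determined_le[OF assms(2,1,3), of p] eq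
    by (metis linear)
qed


section \<open>The closing moment and its gradient\<close>

lemma det_nz_of_left_kernel:
  fixes D :: "real mat"
  assumes D: "D \<in> carrier_mat n n"
    and ker: "\<And>v. (\<And>k. k < n \<Longrightarrow> (\<Sum>j<n. v j * D $$ (j, k)) = 0) \<Longrightarrow> \<forall>j<n. v j = 0"
  shows "det D \<noteq> 0"
proof
  assume "det D = 0"
  then have "det (transpose_mat D) = 0" using det_transpose[OF D] by simp
  then obtain v where v: "v \<in> carrier_vec n" "v \<noteq> 0\<^sub>v n" "transpose_mat D *\<^sub>v v = 0\<^sub>v n"
    using det_0_iff_vec_prod_zero[of "transpose_mat D" n] D by auto
  have "(\<Sum>j<n. v $ j * D $$ (j, k)) = 0" if "k < n" for k
  proof -
    have "(transpose_mat D *\<^sub>v v) $ k = (\<Sum>j<n. D $$ (j, k) * v $ j)"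
      using that D v(1) by (simp add: scalar_prod_def lessThan_atLeast0)
    then show ?thesis using v(3) that by (simp add: mult.commute)
  qed
  then have "\<forall>j<n. v $ j = 0" by (rule ker)
  then have "v = 0\<^sub>v n" using v(1) by auto
  then show False using v(2) by simp
qed

lemma inverse_entries:
  fixes D :: "real mat"
  assumes D: "D \<in> carrier_mat n n" and "det D \<noteq> 0"
  obtains K where
    "\<And>i j. i < n \<Longrightarrow> j < n \<Longrightarrow> (\<Sum>k<n. K i k * D $$ (k, j)) = (if i = j then 1 else 0)"
    "\<And>i j. i < n \<Longrightarrow> j < n \<Longrightarrow> (\<Sum>k<n. D $$ (i, k) * K k j) = (if i = j then 1 else 0)"
proof -
  obtain B where B: "B \<in> carrier_mat n n" "B * D = 1\<^sub>m n" "D * B = 1\<^sub>m n"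
    using det_non_zero_imp_unit[OF D assms(2), unfolded Units_def ring_mat_def] by auto
  show thesis
  proof (rule that[of "\<lambda>i j. B $$ (i, j)"])
    fix i j assume ij: "i < n" "j < n"
    have "(B * D) $$ (i, j) = (\<Sum>k<n. B $$ (i, k) * D $$ (k, j))"
      using ij B(1) D by (simp add: scalar_prod_def lessThan_atLeast0)
    then show "(\<Sum>k<n. B $$ (i, k) * D $$ (k, j)) = (if i = j then 1 else 0)"
      using ij B by simp
    have "(D * B) $$ (i, j) = (\<Sum>k<n. D $$ (i, k) * B $$ (k, j))"
      using ij B(1) D by (simp add: scalar_prod_def lessThan_atLeast0)
    then show "(\<Sum>k<n. D $$ (i, k) * B $$ (k, j)) = (if i = j then 1 else 0)"
      using ij B by simp
  qed
qed

lemma Omega_open_iff: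
  "W \<in> Omega_open N \<longleftrightarrow> W \<in> carrier_vec (2 * N + 1) \<and> open_nodes N (\<lambda>k. W $ k)"
  by (auto simp: Omega_open_def open_nodes_def weight_def node_def node_var_def inj_on_def)

lemma eqmom_moment_eq:
  "0 < node_var N W \<Longrightarrow> eqmom_moment N W j = mom N (\<lambda>k. W $ k) (monom 1 j)"
  by (simp add: eqmom_moment_def mom_def gauss_moment_eq weight_def node_def node_var_def)

lemma Omega_open_node_var: "W \<in> Omega_open N \<Longrightarrow> 0 < node_var N W"
  by (simp add: Omega_open_def)

text \<open>All mixtures with distinct nodes and the given moments share the moment of order \<open>2N + 1\<close>.\<close>

lemma closing_moment_eq:
  assumes W: "W \<in> Omega_open N" and N: "1 \<le> N"
  shows "closing_moment N (moment_map N W) = mom N (\<lambda>k. W $ k) (monom 1 (2 * N + 1))"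
  unfolding closing_moment_def
proof (rule the_equality)
  show "\<exists>W'\<in>Omega_open N. moment_map N W' = moment_map N W \<and>
      mom N (\<lambda>k. W $ k) (monom 1 (2 * N + 1)) = eqmom_moment N W' (2 * N + 1)"
    using W eqmom_moment_eq[OF Omega_open_node_var[OF W]] by auto
next
  fix m assume "\<exists>W'\<in>Omega_open N. moment_map N W' = moment_map N W \<and> m = eqmom_moment N W' (2 * N + 1)"
  then obtain W' where W': "W' \<in> Omega_open N" "moment_map N W' = moment_map N W"
    "m = eqmom_moment N W' (2 * N + 1)" by blast
  have "mom N (\<lambda>k. W' $ k) (monom 1 j) = mom N (\<lambda>k. W $ k) (monom 1 j)" if "j < 2 * N + 1" for j
  proof -
    have "moment_map N W' $ j = moment_map N W $ j" using W'(2) by simp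
    then show ?thesis
      using that eqmom_moment_eq[OF Omega_open_node_var[OF W]] eqmom_moment_eq[OF Omega_open_node_var[OF W'(1)]]
      by (simp add: moment_map_def)
  qed
  then show "m = mom N (\<lambda>k. W $ k) (monom 1 (2 * N + 1))"
    using mom_determined[of N "\<lambda>k. W' $ k" "\<lambda>k. W $ k" "monom 1 (2 * N + 1)"] W W'(1) N
    unfolding W'(3) eqmom_moment_eq[OF Omega_open_node_var[OF W'(1)]] Omega_open_iff by auto
qed

lemma mom_cong: "(\<And>k. k < 2 * N + 1 \<Longrightarrow> c k = c' k) \<Longrightarrow> mom N c p = mom N c' p"
  unfolding mom_def by (auto intro!: sum.cong)

lemma dmom_cong: "(\<And>k. k < 2 * N + 1 \<Longrightarrow> c k = c' k) \<Longrightarrow> k < 2 * N + 1 \<Longrightarrow> dmom N c p k = dmom N c' p k"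
  unfolding dmom_def by (auto intro!: sum.cong elim: evenE oddE)

lemma open_nodes_cong: "(\<And>k. k < 2 * N + 1 \<Longrightarrow> c k = c' k) \<Longrightarrow> open_nodes N c = open_nodes N c'"
  unfolding open_nodes_def by (auto simp: inj_on_def)

text \<open>The constraints on the parameters are finitely many strict inequalities, so they persist along a
continuous curve.\<close>

lemma eventually_open_nodes:
  assumes "open_nodes N (coord (\<gamma> 0))" and "isCont \<gamma> (0 :: real)"
  shows "\<forall>\<^sub>F t in nhds 0. open_nodes N (coord (\<gamma> t))"
proof -
  have c: "((\<lambda>t. coord (\<gamma> t) k) \<longlongrightarrow> coord (\<gamma> 0) k) (nhds 0)" for k
    using isCont_o2[OF assms(2) linear_continuous_at[OF bounded_linear_coord[of k]]]
    by (simp add: isCont_def tendsto_nhds_iff)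
  have 1: "\<forall>\<^sub>F t in nhds 0. 0 < coord (\<gamma> t) k" if "0 < coord (\<gamma> 0) k" for k
    using order_tendstoD(1)[OF c that] .
  have 2: "\<forall>\<^sub>F t in nhds 0. coord (\<gamma> t) k \<noteq> coord (\<gamma> t) l" if "coord (\<gamma> 0) k \<noteq> coord (\<gamma> 0) l" for k l
    using tendsto_imp_eventually_ne[OF tendsto_diff[OF c[of k] c[of l]], of 0] that by simp
  have "\<forall>\<^sub>F t in nhds 0. \<forall>i\<in>{..<N}. 0 < coord (\<gamma> t) (2 * i)"
    by (intro eventually_ball_finite ballI 1) (use assms(1) in \<open>auto simp: open_nodes_def\<close>)
  moreover have "\<forall>\<^sub>F t in nhds 0. 0 < coord (\<gamma> t) (2 * N)"
    by (rule 1) (use assms(1) in \<open>auto simp: open_nodes_def\<close>)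
  moreover have "\<forall>\<^sub>F t in nhds 0. \<forall>i\<in>{..<N}. \<forall>j\<in>{..<N} - {i}. coord (\<gamma> t) (2 * i + 1) \<noteq> coord (\<gamma> t) (2 * j + 1)"
    by (intro eventually_ball_finite ballI 2) (use assms(1) in \<open>auto simp: open_nodes_def inj_on_def\<close>)
  ultimately show ?thesis
    by eventually_elim (auto simp: open_nodes_def inj_on_def)
qed

text \<open>In other words, the expectation of \<open>P = x^(2N+1) - (\<Sum>j. a j x^j)\<close>, where \<open>a\<close> is the gradient, is stationary
in all parameters. The parameters can be moved so that only the moment \<open>M\<^sub>j\<close> changes, at unit
speed; following such a curve gives the partial derivative in direction \<open>j\<close> in terms of the inverse \<open>K\<close>
of the Jacobian \<open>D\<close> of the moment map.\<close>

lemma closing_moment_gradient: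
  assumes W: "W \<in> Omega_open N" and N: "1 \<le> N" and k: "k < 2 * N + 1"
  shows "(\<Sum>j<2 * N + 1. partial_deriv (closing_moment N) j (moment_map N W) * dmom N (\<lambda>k. W $ k) (monom 1 j) k)
      = dmom N (\<lambda>k. W $ k) (monom 1 (2 * N + 1)) k"
proof -
  let ?n = "2 * N + 1"
  let ?c = "\<lambda>k. W $ k"
  define x0 where "x0 = fin_bseq ?n ?c"
  have x0: "coord x0 i = W $ i" if "i < ?n" for i using that by (simp add: x0_def)
  have o0: "open_nodes N (coord x0)"
    using W open_nodes_cong[of N "coord x0" ?c] x0 by (simp add: Omega_open_iff)
  define M where "M = moment_map N W"
  have M: "M \<in> carrier_vec ?n" by (simp add: M_def moment_map_def)
  have Mj: "M $ i = mom N (coord x0) (monom 1 i)" if "i < ?n" for i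
    using that eqmom_moment_eq[OF Omega_open_node_var[OF W]] mom_cong[of N "coord x0" ?c] x0
    by (simp add: M_def moment_map_def)
  define D where "D = mat ?n ?n (\<lambda>(j, k). dmom N (coord x0) (monom 1 j) k)"
  have D: "D \<in> carrier_mat ?n ?n" by (simp add: D_def)
  have "det D \<noteq> 0"
  proof (rule det_nz_of_left_kernel[OF D])
    \<comment> \<open>A vector in the left kernel is a polynomial whose expectation is stationary in all parameters.\<close>
    fix v :: "nat \<Rightarrow> real"
    assume z: "\<And>k. k < ?n \<Longrightarrow> (\<Sum>j<?n. v j * D $$ (j, k)) = 0"
    let ?p = "\<Sum>j<?n. Polynomial.smult (v j) (monom 1 j)"
    have "?p = 0"
    proof (rule dmom_injective[OF o0 N])
      show "degree ?p \<le> 2 * N"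
        by (rule degree_sum_le) (auto intro!: order.trans[OF degree_smult_le] order.trans[OF degree_monom_le])
      show "dmom N (coord x0) ?p k = 0" if "k < 2 * N + 1" for k
        using z[OF that] that unfolding dmom_sum by (simp add: D_def)
    qed
    then show "\<forall>j<?n. v j = 0"
      using coeff_sum_monom[of _ ?n v] by (simp del: sum.lessThan_Suc)
  qed
  then obtain K where K: "\<And>i j. i < ?n \<Longrightarrow> j < ?n \<Longrightarrow> (\<Sum>k<?n. K i k * D $$ (k, j)) = (if i = j then 1 else 0)"
    "\<And>i j. i < ?n \<Longrightarrow> j < ?n \<Longrightarrow> (\<Sum>k<?n. D $$ (i, k) * K k j) = (if i = j then 1 else 0)"
    using inverse_entries[OF D] by blast
  have grad: "partial_deriv (closing_moment N) j M = (\<Sum>l<?n. dmom N (coord x0) (monom 1 ?n) l * K l j)"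
    if j: "j < ?n" for j
  proof -
    obtain \<gamma> v where \<gamma>: "\<gamma> 0 = x0" "(\<gamma> has_derivative (\<lambda>t. t *\<^sub>R v)) (at 0)"
      "\<And>k. k < ?n \<Longrightarrow> coord v k = K k j"
      "\<forall>\<^sub>F t in nhds 0. \<forall>i<?n. mom N (coord (\<gamma> t)) (monom 1 i) = mom N (coord x0) (monom 1 i) + (if i = j then t else 0)"
    proof (rule coordinate_curve[of ?n "\<lambda>i x. mom N (coord x) (monom 1 i)" "\<lambda>i k x. dmom N (coord x) (monom 1 i) k" x0 K j])
      show "(\<Sum>k<?n. K i k * dmom N (coord x0) (monom 1 k) l) = (if i = l then 1 else 0)" if "i < ?n" "l < ?n" for i l
        using K(1)[OF that] that by (simp add: D_def)
      show "(\<Sum>k<?n. dmom N (coord x0) (monom 1 i) k * K k l) = (if i = l then 1 else 0)" if "i < ?n" "l < ?n" for i l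
        using K(2)[OF that] that by (simp add: D_def)
    qed (use has_derivative_mom isCont_dmom j in auto)
    have "isCont \<gamma> 0" using \<gamma>(2) by (rule has_derivative_continuous)
    then have "\<forall>\<^sub>F t in nhds 0. open_nodes N (coord (\<gamma> t))"
      using eventually_open_nodes[of N \<gamma>] o0 \<gamma>(1) by simp
    then have ev: "\<forall>\<^sub>F t in nhds 0. closing_moment N (update_vec M j (M $ j + t)) = mom N (coord (\<gamma> t)) (monom 1 ?n)"
      using \<gamma>(4)
    proof eventually_elim
      case (elim t)
      define W' where "W' = vec ?n (coord (\<gamma> t))"
      have W'c: "W' $ i = coord (\<gamma> t) i" if "i < ?n" for i using that by (simp add: W'_def)
      have W': "W' \<in> Omega_open N"
        unfolding Omega_open_iff using open_nodes_cong[of N "\<lambda>k. W' $ k" "coord (\<gamma> t)"] W'c elim(1)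
        by (simp add: W'_def)
      have m: "mom N (\<lambda>k. W' $ k) p = mom N (coord (\<gamma> t)) p" for p
        by (rule mom_cong[OF W'c])
      have "moment_map N W' = update_vec M j (M $ j + t)"
      proof (rule eq_vecI)
        fix i assume "i < dim_vec (update_vec M j (M $ j + t))"
        then have i: "i < ?n" using M by (simp add: update_vec_def)
        show "moment_map N W' $ i = update_vec M j (M $ j + t) $ i"
          using i M elim(2) j by (simp add: moment_map_def eqmom_moment_eq[OF Omega_open_node_var[OF W']] m Mj update_vec_def)
      qed (use M in \<open>simp add: moment_map_def update_vec_def\<close>)
      then show ?case using closing_moment_eq[OF W' N] m by simp
    qed
    have "((\<lambda>t. mom N (coord (\<gamma> t)) (monom 1 ?n)) has_derivative
        (\<lambda>t. \<Sum>l<?n. dmom N (coord x0) (monom 1 ?n) l * coord (t *\<^sub>R v) l)) (at 0)"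
      using has_derivative_compose[OF \<gamma>(2) has_derivative_mom[of N "monom 1 ?n" "\<gamma> 0"]] \<gamma>(1) by simp
    moreover have "(\<Sum>l<?n. dmom N (coord x0) (monom 1 ?n) l * coord (t *\<^sub>R v) l)
        = (\<Sum>l<?n. dmom N (coord x0) (monom 1 ?n) l * K l j) * t" for t
      unfolding sum_distrib_right by (intro sum.cong) (auto simp: scaleR_bcontfun.rep_eq \<gamma>(3))
    ultimately have "((\<lambda>t. mom N (coord (\<gamma> t)) (monom 1 ?n)) has_field_derivative
        (\<Sum>l<?n. dmom N (coord x0) (monom 1 ?n) l * K l j)) (at 0)"
      by (simp add: has_field_derivative_def)
    then have "((\<lambda>t. closing_moment N (update_vec M j (M $ j + t))) has_field_derivative
        (\<Sum>l<?n. dmom N (coord x0) (monom 1 ?n) l * K l j)) (at 0)"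
      using DERIV_cong_ev[OF refl ev refl] by blast
    then have "((\<lambda>t. closing_moment N (update_vec M j t)) has_field_derivative
        (\<Sum>l<?n. dmom N (coord x0) (monom 1 ?n) l * K l j)) (at (M $ j))"
      using DERIV_shift[of "\<lambda>t. closing_moment N (update_vec M j t)" _ 0 "M $ j"] by (simp add: add.commute)
    then show ?thesis unfolding partial_deriv_def by (rule DERIV_imp_deriv)
  qed
  have "(\<Sum>j<?n. partial_deriv (closing_moment N) j M * dmom N (coord x0) (monom 1 j) k)
      = (\<Sum>j<?n. \<Sum>l<?n. dmom N (coord x0) (monom 1 ?n) l * (K l j * D $$ (j, k)))"
    by (intro sum.cong refl) (use k in \<open>simp add: grad sum_distrib_right distrib_right D_def mult.assoc\<close>)
  also have "\<dots> = (\<Sum>l<?n. dmom N (coord x0) (monom 1 ?n) l * (\<Sum>j<?n. K l j * D $$ (j, k)))"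
    unfolding sum_distrib_left by (rule sum.swap)
  also have "\<dots> = (\<Sum>l<?n. if l = k then dmom N (coord x0) (monom 1 ?n) l else 0)"
    by (intro sum.cong refl) (use k K(1) in auto)
  also have "\<dots> = dmom N (coord x0) (monom 1 ?n) k" using k by simp
  finally show ?thesis
    unfolding M_def using dmom_cong[of N "coord x0" ?c k] x0 k by simp
qed


section \<open>Hyperbolicity away from equilibrium\<close>

text \<open>Each root is listed twice, so that \<open>backward_heat_real_roots\<close> applies to the squared node polynomial.\<close>

lemma monic_roots_square: "(monic_roots N u)\<^sup>2 = monic_roots (2 * N) (\<lambda>i. u (i div 2))"
proof (induction N)
  case 0
  show ?case by (simp add: monic_roots_def)
next
  case (Suc N)
  have "monic_roots (2 * Suc N) (\<lambda>i. u (i div 2)) = [:- u N, 1:] * ([:- u N, 1:] * monic_roots (2 * N) (\<lambda>i. u (i div 2)))"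
    by (simp add: monic_roots_Suc del: mult_pCons_left mult_pCons_right)
  then show ?case
    unfolding Suc.IH[symmetric] monic_roots_Suc power2_eq_square by (simp only: mult_ac)
qed

lemma monic_roots_cong: "(\<And>i. i < n \<Longrightarrow> r i = r' i) \<Longrightarrow> monic_roots n r = monic_roots n r'"
  unfolding monic_roots_def by (intro prod.cong) auto

text \<open>The product with the Vandermonde matrix is diagonal without zeros.\<close>

lemma det_lagrange_rows_nz:
  assumes deg: "\<And>k. k < n \<Longrightarrow> degree (g k) < n"
    and roots: "\<And>k l. k < n \<Longrightarrow> l < n \<Longrightarrow> poly (g k) (r l) = 0 \<longleftrightarrow> k \<noteq> l"
  shows "det (rows_mat n g) \<noteq> 0"
proof
  assume z: "det (rows_mat n g) = 0"
  define V where "V = mat n n (\<lambda>(j, l). r l ^ j)"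
  have V: "V \<in> carrier_mat n n" by (simp add: V_def)
  have e: "(rows_mat n g * V) $$ (k, l) = poly (g k) (r l)" if "k < n" "l < n" for k l
  proof -
    have "(rows_mat n g * V) $$ (k, l) = (\<Sum>i<n. coeff (g k) i * r l ^ i)"
      using rows_mat_mult_index[OF V that] that by (simp add: V_def)
    also have "\<dots> = (\<Sum>i\<le>degree (g k). coeff (g k) i * r l ^ i)"
      by (rule sum.mono_neutral_right) (use deg[OF that(1)] in \<open>auto simp: coeff_eq_0\<close>)
    finally show ?thesis by (simp add: poly_altdef)
  qed
  have "det (rows_mat n g * V) = prod_list (diag_mat (rows_mat n g * V))"
    by (rule det_upper_triangular) (use V e roots in \<open>auto simp: upper_triangular_def rows_mat_def\<close>)
  also have "\<dots> \<noteq> 0"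
    using e roots V by (auto simp: prod_list_zero_iff diag_mat_def rows_mat_def)
  finally show False using det_mult[of "rows_mat n g" n V] V z by simp
qed

text \<open>For \<open>g k = P / (x - r k)\<close>, multiplication by \<open>x\<close> modulo \<open>P\<close> is multiplication by \<open>r k\<close>.\<close>

lemma strictly_hyperbolic_symmetrizer:
  fixes A :: "real mat"
  assumes A: "A = mat n n (\<lambda>(i, j). if i = n - 1 then a j else if j = i + 1 then 1 else 0)"
    and r: "strict_mono_on {..<n} r" and P: "\<And>j. j < n \<Longrightarrow> coeff (monic_roots n r) j = - a j" and n: "0 < n"
  shows "\<exists>B. sym_pos_def n B \<and> B * A = transpose_mat A * B"
proof -
  define g where "g k = (\<Prod>i\<in>{..<n} - {k}. [:- r i, 1:])" for k
  have split: "monic_roots n r = [:- r k, 1:] * g k" if "k < n" for k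
    unfolding monic_roots_def g_def by (rule prod.remove) (use that in auto)
  have dg: "degree (g k) < n" if "k < n" for k
  proof -
    have "degree (g k) = n - 1" unfolding g_def using that by (subst degree_prod_eq_sum_degree) auto
    then show ?thesis using n by simp
  qed
  have ev: "poly (g k) (r l) = 0 \<longleftrightarrow> k \<noteq> l" if "k < n" "l < n" for k l
    using that strict_mono_on_imp_inj_on[OF r] unfolding g_def poly_prod
    by (auto simp: inj_on_def)
  have det: "det (rows_mat n g) \<noteq> 0" by (rule det_lagrange_rows_nz[OF dg ev])
  have "transpose_mat (rows_mat n g) * rows_mat n g * A = transpose_mat A * (transpose_mat (rows_mat n g) * rows_mat n g)"
  proof (rule companion_symmetrizer[OF A, where P = "monic_roots n r" and J = "\<lambda>k l. if k = l then r k else 0" and \<gamma> = "\<lambda>_. 1"])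
    fix k assume k: "k < n"
    have "(\<Sum>l<n. Polynomial.smult (if k = l then r k else 0) (g l)) = (\<Sum>l<n. if l = k then Polynomial.smult (r k) (g k) else 0)"
      by (intro sum.cong) auto
    then show "pCons 0 (g k) = (\<Sum>l<n. Polynomial.smult (if k = l then r k else 0) (g l)) + Polynomial.smult 1 (monic_roots n r)"
      using k unfolding split[OF k] by simp
  qed (use P n dg in auto)
  moreover have "sym_pos_def n (transpose_mat (rows_mat n g) * rows_mat n g)"
    by (rule gram_sym_pos_def[OF rows_mat_carrier det])
  ultimately show ?thesis by blast
qed

text \<open>Stationarity makes \<open>heat s P\<close> divisible by the squared node polynomial; the quotient is monic of degree one,
so the last root is real as well.\<close>

lemma coeff_matrix_symmetrizer_open:
  assumes W: "W \<in> Omega_open N" and N: "1 \<le> N"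
  shows "\<exists>B. sym_pos_def (2 * N + 1) B \<and>
    B * coeff_matrix N (moment_map N W) = transpose_mat (coeff_matrix N (moment_map N W)) * B"
proof -
  let ?n = "2 * N + 1"
  let ?c = "\<lambda>k. W $ k" and ?s = "W $ (2 * N)"
  define a where "a j = partial_deriv (closing_moment N) j (moment_map N W)" for j
  have o: "open_nodes N ?c" using W by (simp add: Omega_open_iff)
  define P where "P = monom 1 ?n + (\<Sum>j<?n. Polynomial.smult (- a j) (monom 1 j))"
  have low: "degree (\<Sum>j<?n. Polynomial.smult (- a j) (monom 1 j)) < ?n"
    by (rule degree_sum_less) (auto intro!: order.strict_trans1[OF degree_smult_le] order.strict_trans1[OF degree_monom_le])
  have degP: "degree P = ?n"
    unfolding P_def using degree_add_eq_left[of _ "monom 1 ?n :: real poly"] low by (simp add: degree_monom_eq)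
  have lcP: "coeff P ?n = 1"
    unfolding P_def coeff_add coeff_eq_0[OF low] by simp
  have cP: "coeff P j = - a j" if "j < ?n" for j
    unfolding P_def coeff_add coeff_sum_monom[OF that] using that by simp
  have "dmom N ?c P k = 0" if "k < ?n" for k
    unfolding P_def dmom_add dmom_sum using closing_moment_gradient[OF W N that]
    by (simp add: a_def sum_negf del: sum.lessThan_Suc)
  then have "(node_poly N ?c)\<^sup>2 dvd heat ?s P"
    by (intro dmom_zero_dvd[OF o]) auto
  then obtain l where l: "heat ?s P = (node_poly N ?c)\<^sup>2 * l" by (elim dvdE)
  have "heat ?s P \<noteq> 0" using degP degree_heat[of ?s P] by (metis degree_0 add_is_0 one_neq_zero)
  then have nz: "l \<noteq> 0" using l by auto
  then have "?n = 2 * N + degree l"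
    using degree_heat[of ?s P] degP degree_mult_eq[of "(node_poly N ?c)\<^sup>2" l] node_poly_nz[of N ?c]
    unfolding l by (simp add: degree_node_poly_sq)
  then have "degree l = 1" by simp
  then have "l = [:coeff l 0, coeff l 1:]"
    by (intro poly_eqI) (auto simp: coeff_pCons coeff_eq_0 split: nat.splits)
  then obtain b d where bd: "l = [:b, d:]" by blast
  have q: "(node_poly N ?c)\<^sup>2 = monic_roots (2 * N) (\<lambda>i. W $ (2 * (i div 2) + 1))"
    by (simp add: node_poly_def monic_roots_square)
  have "lead_coeff (heat ?s P) = lead_coeff ((node_poly N ?c)\<^sup>2) * lead_coeff l"
    unfolding l by (rule lead_coeff_mult)
  moreover have "lead_coeff (heat ?s P) = 1" using coeff_heat_top[of P ?n ?s] degP lcP by simp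
  moreover have "lead_coeff ((node_poly N ?c)\<^sup>2) = 1" unfolding q by simp
  ultimately have "d = 1" using bd \<open>degree l = 1\<close> by (simp del: degree_pCons_eq_if)
  \<comment> \<open>The nodes, each twice, followed by the root of the linear quotient.\<close>
  define r0 where "r0 i = (if i < 2 * N then W $ (2 * (i div 2) + 1) else - b)" for i
  have "heat ?s P = monic_roots ?n r0"
  proof -
    have "monic_roots ?n r0 = [:b, 1:] * monic_roots (2 * N) r0" by (simp add: monic_roots_Suc r0_def)
    also have "monic_roots (2 * N) r0 = (node_poly N ?c)\<^sup>2"
      unfolding q by (rule monic_roots_cong) (simp add: r0_def)
    finally show ?thesis unfolding l bd \<open>d = 1\<close> by (simp only: mult.commute)
  qed
  then have "P = heat (- ?s) (monic_roots ?n r0)" by (metis heat_heat heat_0 add.left_inverse)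
  moreover have "0 < ?s" using Omega_open_node_var[OF W] by (simp add: node_var_def)
  ultimately obtain r where r: "strict_mono_on {..<?n} r" "P = monic_roots ?n r"
    using backward_heat_real_roots[of ?s ?n r0] by metis
  show ?thesis
  proof (rule strictly_hyperbolic_symmetrizer[OF _ r(1)])
    show "coeff_matrix N (moment_map N W) = mat ?n ?n
        (\<lambda>(i, j). if i = ?n - 1 then a j else if j = i + 1 then 1 else 0)"
      using W by (auto simp: coeff_matrix_def closure_coeff_def a_def intro!: eq_matI)
    show "coeff (monic_roots ?n r) j = - a j" if "j < ?n" for j
      using cP[OF that] r(2) by simp
  qed simp
qed


section \<open>The Hermite basis at equilibrium\<close>

text \<open>The monic polynomials orthogonal with respect to the Gaussian of mean \<open>U\<close> and variance \<open>t\<close>.\<close>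

definition hermite :: "real \<Rightarrow> real \<Rightarrow> nat \<Rightarrow> real poly" where
  "hermite U t k = heat (- t) ([:- U, 1:] ^ k)"

text \<open>The norm of \<open>hermite U t k\<close> in the Gaussian space; dividing by it makes the recurrence symmetric.\<close>

definition hermite_norm :: "real \<Rightarrow> nat \<Rightarrow> real" where
  "hermite_norm t k = sqrt (fact k * t ^ k)"

definition normalized_hermite :: "real \<Rightarrow> real \<Rightarrow> nat \<Rightarrow> real poly" where
  "normalized_hermite U t k = Polynomial.smult (1 / hermite_norm t k) (hermite U t k)"

lemma degree_hermite [simp]: "degree (hermite U t k) = k"
  by (simp add: hermite_def degree_linear_power)

lemma coeff_hermite_top [simp]: "coeff (hermite U t k) k = 1"
  by (simp add: hermite_def coeff_heat_top degree_linear_power coeff_linear_power)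

lemma heat_hermite: "heat s (hermite U t k) = heat (s - t) ([:- U, 1:] ^ k)"
  by (simp add: hermite_def heat_heat)

lemma hermite_norm_pos: "0 < t \<Longrightarrow> 0 < hermite_norm t k"
  by (simp add: hermite_norm_def)

lemma hermite_norm_Suc: "hermite_norm t (Suc k) = sqrt (real (Suc k) * t) * hermite_norm t k"
  unfolding hermite_norm_def real_sqrt_mult[symmetric] by (simp add: mult_ac)

lemma degree_normalized_hermite: "0 < t \<Longrightarrow> degree (normalized_hermite U t k) = k"
  using hermite_norm_pos[of t k] by (simp add: normalized_hermite_def)

lemma pderiv_hermite: "pderiv (hermite U t k) = Polynomial.smult (real k) (hermite U t (k - 1))"
  unfolding hermite_def heat_pderiv[symmetric]
  by (cases k) (simp_all add: pderiv_power_Suc pderiv_pCons heat_smult del: power_Suc of_nat_Suc)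

lemma hermite_recurrence:
  "pCons 0 (hermite U t k) = Polynomial.smult U (hermite U t k) + hermite U t (Suc k)
     + Polynomial.smult (real k * t) (hermite U t (k - 1))"
proof -
  have "hermite U t (Suc k) = [:- U, 1:] * hermite U t k - Polynomial.smult (t * real k) (hermite U t (k - 1))"
    using heat_linear_factor[of "- t" U "[:- U, 1:] ^ k"] pderiv_hermite[of U t k]
    unfolding hermite_def power_Suc by simp
  then show ?thesis by (simp add: mult.commute)
qed

text \<open>The tridiagonal matrix of multiplication by \<open>x\<close> in the normalized Hermite basis.\<close>

definition jacobi_entry :: "real \<Rightarrow> real \<Rightarrow> nat \<Rightarrow> nat \<Rightarrow> real" where
  "jacobi_entry U t k l = (if l = k then U else if l = Suc k then sqrt (real l * t)
     else if k = Suc l then sqrt (real k * t) else 0)"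

lemma jacobi_entry_sym: "jacobi_entry U t k l = jacobi_entry U t l k"
  by (auto simp: jacobi_entry_def)

lemma normalized_hermite_recurrence:
  assumes t: "0 < t"
  shows "pCons 0 (normalized_hermite U t k) = Polynomial.smult U (normalized_hermite U t k)
     + Polynomial.smult (sqrt (real (Suc k) * t)) (normalized_hermite U t (Suc k))
     + Polynomial.smult (sqrt (real k * t)) (normalized_hermite U t (k - 1))"
proof -
  have b: "hermite_norm t k \<noteq> 0" for k using hermite_norm_pos[OF t, of k] by simp
  have 1: "sqrt (real (Suc k) * t) * (1 / hermite_norm t (Suc k)) = 1 / hermite_norm t k"
    unfolding hermite_norm_Suc using t by (simp del: of_nat_Suc)
  have 2: "sqrt (real k * t) * (1 / hermite_norm t (k - 1)) = 1 / hermite_norm t k * (real k * t)"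
  proof (cases k)
    case (Suc m)
    have "sqrt (real k * t) * sqrt (real k * t) = real k * t" using t by simp
    then show ?thesis using b[of m] t unfolding Suc hermite_norm_Suc
      by (simp add: field_simps del: of_nat_Suc)
  qed simp
  have "pCons 0 (normalized_hermite U t k) = Polynomial.smult (1 / hermite_norm t k) (pCons 0 (hermite U t k))"
    by (simp add: normalized_hermite_def)
  then show ?thesis
    unfolding hermite_recurrence normalized_hermite_def smult_smult 1 2 smult_add_right
    by (simp add: mult.commute)
qed

text \<open>The three-term recurrence; the first polynomial beyond the basis, for \<open>k = n - 1\<close>, is a multiple of
\<open>hermite U t n\<close>.\<close>

lemma normalized_hermite_multiplication:
  assumes t: "0 < t" and k: "k < n"
  shows "pCons 0 (normalized_hermite U t k) = (\<Sum>l<n. Polynomial.smult (jacobi_entry U t k l) (normalized_hermite U t l))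
     + Polynomial.smult (if Suc k = n then 1 / hermite_norm t k else 0) (hermite U t n)"
proof -
  let ?g = "normalized_hermite U t"
  have "(\<Sum>l<n. Polynomial.smult (jacobi_entry U t k l) (?g l))
      = (\<Sum>l<n. (if l = k then Polynomial.smult U (?g k) else 0)
          + (if l = Suc k then Polynomial.smult (sqrt (real (Suc k) * t)) (?g (Suc k)) else 0)
          + (if Suc l = k then Polynomial.smult (sqrt (real k * t)) (?g (k - 1)) else 0))"
    by (intro sum.cong) (auto simp: jacobi_entry_def)
  also have "\<dots> = Polynomial.smult U (?g k)
      + (if Suc k < n then Polynomial.smult (sqrt (real (Suc k) * t)) (?g (Suc k)) else 0)
      + Polynomial.smult (sqrt (real k * t)) (?g (k - 1))"
    unfolding sum.distrib using k by (cases k) auto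
  finally have S: "(\<Sum>l<n. Polynomial.smult (jacobi_entry U t k l) (?g l)) = Polynomial.smult U (?g k)
      + (if Suc k < n then Polynomial.smult (sqrt (real (Suc k) * t)) (?g (Suc k)) else 0)
      + Polynomial.smult (sqrt (real k * t)) (?g (k - 1))" .
  show ?thesis
  proof (cases "Suc k = n")
    case True
    have "Polynomial.smult (sqrt (real (Suc k) * t)) (?g (Suc k)) = Polynomial.smult (1 / hermite_norm t k) (hermite U t n)"
      using t True unfolding normalized_hermite_def hermite_norm_Suc by (simp del: of_nat_Suc)
    then show ?thesis unfolding S normalized_hermite_recurrence[OF t] using True by simp
  next
    case False
    then show ?thesis unfolding S normalized_hermite_recurrence[OF t] using k by simp
  qed
qed

lemma det_hermite_rows_nz:
  assumes "0 < t"
  shows "det (rows_mat n (normalized_hermite U t)) \<noteq> 0"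
proof -
  have "det (rows_mat n (normalized_hermite U t)) = prod_list (diag_mat (rows_mat n (normalized_hermite U t)))"
    by (rule det_lower_triangular[of n])
       (auto simp: rows_mat_def coeff_eq_0 degree_normalized_hermite[OF assms])
  also have "\<dots> \<noteq> 0"
    using hermite_norm_pos[OF assms]
    by (auto simp: prod_list_zero_iff diag_mat_def rows_mat_def normalized_hermite_def less_imp_neq[symmetric])
  finally show ?thesis .
qed

lemma eq_char_poly_hermite: "eq_char_poly N M = hermite (macro_U M) (macro_theta M) (2 * N + 1)"
proof -
  have "degree ([:- macro_U M, 1:] ^ (2 * N + 1)) < 2 * Suc N"
    unfolding degree_linear_power by simp
  then show ?thesis
    unfolding eq_char_poly_def hermite_def by (simp add: heat_cutoff del: power_Suc)
qed

abbreviation hermite_rows :: "nat \<Rightarrow> real vec \<Rightarrow> real mat" where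
  "hermite_rows N M \<equiv> rows_mat (2 * N + 1) (normalized_hermite (macro_U M) (macro_theta M))"

lemma coeff_matrix_symmetrizer_eq:
  assumes M: "M \<notin> moment_map N ` Omega_open N" and t: "0 < macro_theta M"
  shows "sym_pos_def (2 * N + 1) (transpose_mat (hermite_rows N M) * hermite_rows N M)"
    and "transpose_mat (hermite_rows N M) * hermite_rows N M * coeff_matrix N M
       = transpose_mat (coeff_matrix N M) * (transpose_mat (hermite_rows N M) * hermite_rows N M)"
proof -
  let ?n = "2 * N + 1" and ?U = "macro_U M" and ?t = "macro_theta M"
  show "sym_pos_def ?n (transpose_mat (hermite_rows N M) * hermite_rows N M)"
    by (rule gram_sym_pos_def[OF rows_mat_carrier det_hermite_rows_nz[OF t]])
  show "transpose_mat (hermite_rows N M) * hermite_rows N M * coeff_matrix N M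
       = transpose_mat (coeff_matrix N M) * (transpose_mat (hermite_rows N M) * hermite_rows N M)"
  proof (rule companion_symmetrizer[where P = "hermite ?U ?t ?n" and J = "jacobi_entry ?U ?t"
        and a = "\<lambda>j. - coeff (hermite ?U ?t ?n) j" and \<gamma> = "\<lambda>k. if Suc k = ?n then 1 / hermite_norm ?t k else 0"])
    show "coeff_matrix N M = mat ?n ?n
        (\<lambda>(i, j). if i = ?n - 1 then - coeff (hermite ?U ?t ?n) j else if j = i + 1 then 1 else 0)"
      using M by (auto simp: coeff_matrix_def closure_coeff_def eq_char_poly_hermite intro!: eq_matI)
  qed (use normalized_hermite_multiplication[OF t] jacobi_entry_sym degree_normalized_hermite[OF t] in auto)
qed


section \<open>The linearized collision term\<close>

lemma poly_heat_monom_low: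
  "poly (heat t (monom 1 0)) u = 1"
  "poly (heat t (monom 1 (Suc 0))) u = u"
  "poly (heat t (monom 1 2)) u = u\<^sup>2 + t"
proof -
  have h1: "heat t (monom 1 (Suc 0)) = monom 1 (Suc 0)"
    using heat_pCons_0[of t 1] by (simp add: monom_Suc monom_0 one_pCons)
  show "poly (heat t (monom 1 0)) u = 1" by (simp add: monom_0)
  show "poly (heat t (monom 1 (Suc 0))) u = u" unfolding h1 by (simp add: poly_monom)
  have "monom (1 :: real) 2 = pCons 0 (monom 1 (Suc 0))" by (simp add: monom_Suc numeral_2_eq_2)
  then have "heat t (monom 1 2) = pCons 0 (monom 1 (Suc 0)) + Polynomial.smult t (pderiv (monom 1 (Suc 0)))"
    using heat_pCons_0[of t "monom 1 (Suc 0)"] h1 by simp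
  then show "poly (heat t (monom 1 2)) u = u\<^sup>2 + t"
    by (simp add: poly_monom pderiv_monom monom_0 power2_eq_square)
qed

lemma poly_pderiv_power_centre:
  "2 \<le> k \<Longrightarrow> poly (pderiv ([:- u :: real, 1:] ^ k)) u = 0"
  "3 \<le> k \<Longrightarrow> poly (pderiv (pderiv ([:- u :: real, 1:] ^ k))) u = 0"
proof -
  have d: "pderiv ([:- u :: real, 1:] ^ Suc m) = Polynomial.smult (real (Suc m)) ([:- u, 1:] ^ m)" for m
    by (simp add: pderiv_power_Suc pderiv_pCons del: power_Suc of_nat_Suc)
  show "2 \<le> k \<Longrightarrow> poly (pderiv ([:- u :: real, 1:] ^ k)) u = 0"
    by (cases k) (auto simp: d simp del: power_Suc of_nat_Suc)
  assume "3 \<le> k"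
  then obtain m where "k = Suc (Suc m)" "0 < m" by (metis Suc_le_D numeral_3_eq_3 Suc_le_mono zero_less_Suc)
  then show "poly (pderiv (pderiv ([:- u :: real, 1:] ^ k))) u = 0"
    by (simp add: d pderiv_smult del: power_Suc of_nat_Suc)
qed

text \<open>Write \<open>g\<close> for the normalized Hermite polynomial of order \<open>k\<close> at the given state and pair it with the source at a
nearby state. If \<open>k < 3\<close>, the pairing is zero because the source conserves the moments of order
\<open>0\<close>, \<open>1\<close>, \<open>2\<close>. If \<open>k \<ge> 3\<close>, the Maxwellian part is a multiple of \<open>\<rho>\<close> times the value at \<open>U'\<close> of
\<open>heat (\<theta>' - \<theta>) ((x - U)^k)\<close>, which vanishes together with its first derivatives at \<open>(U', \<theta>') = (U, \<theta>)\<close>, and only the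
loss term \<open>- \<nu> M\<close> contributes.\<close>

lemma hermite_rows_mult_jacobian:
  assumes M: "M \<in> carrier_vec (2 * N + 1)" and N: "1 \<le> N" and rho: "0 < macro_rho M" and th: "0 < macro_theta M"
    and k: "k < 2 * N + 1" and j: "j < 2 * N + 1"
  shows "(hermite_rows N M * jacobian (2 * N + 1) (\<lambda>M. \<nu> \<cdot>\<^sub>v bgk_source N M) M) $$ (k, j)
    = (if k < 3 then 0 else - \<nu> * coeff (normalized_hermite (macro_U M) (macro_theta M) k) j)"
proof -
  let ?n = "2 * N + 1"
  define U where "U = macro_U M"
  define \<theta> where "\<theta> = macro_theta M"
  define g where "g = normalized_hermite U \<theta> k"
  define m where "m i t = update_vec M j t $ i" for i t
  define r where "r = (\<lambda>t. macro_rho (update_vec M j t))"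
  define u where "u = (\<lambda>t. macro_U (update_vec M j t))"
  define s where "s = (\<lambda>t. macro_theta (update_vec M j t))"
  define t0 where "t0 = M $ j"
  have n3: "0 < ?n" "1 < ?n" "2 < ?n" using N by auto
  have up0: "update_vec M j t0 = M"
    using M j by (intro eq_vecI) (auto simp: update_vec_def t0_def)
  have at0: "r t0 = macro_rho M" "u t0 = U" "s t0 = \<theta>"
    by (simp_all add: r_def u_def s_def U_def \<theta>_def up0)
  have th0: "0 < \<theta>" using th by (simp add: \<theta>_def)
  have dm: "(m i has_real_derivative (if i = j then 1 else 0)) (at t)" if "i < ?n" for i t
  proof -
    have "m i = (if i = j then (\<lambda>t. t) else (\<lambda>_. M $ i))"
      using that M by (auto simp: fun_eq_iff m_def update_vec_def)
    then show ?thesis by simp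
  qed
  have rm: "r = m 0" by (simp add: fun_eq_iff r_def m_def macro_rho_def)
  have um: "u = (\<lambda>t. m 1 t / m 0 t)" by (simp add: fun_eq_iff u_def m_def macro_U_def)
  have sm: "s = (\<lambda>t. m 2 t / m 0 t - (u t)\<^sup>2)" by (simp add: fun_eq_iff s_def u_def m_def macro_theta_def)
  have m0: "m 0 t0 \<noteq> 0" using rho at0(1) rm by simp
  obtain r' where r': "(r has_real_derivative r') (at t0)" using dm[OF n3(1)] rm by blast
  \<comment> \<open>It is enough that \<open>u\<close> and \<open>s\<close> are differentiable: their derivatives drop out of the result.\<close>
  have "\<exists>u'. (u has_real_derivative u') (at t0)"
    unfolding um by (rule exI, rule DERIV_divide[OF dm[OF n3(2)] dm[OF n3(1)] m0])
  then obtain u' where u': "(u has_real_derivative u') (at t0)" by blast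
  have "\<exists>s'. (s has_real_derivative s') (at t0)"
    unfolding sm by (rule exI, rule DERIV_diff[OF DERIV_divide[OF dm[OF n3(3)] dm[OF n3(1)] m0] DERIV_power[OF u']])
  then obtain s' where s': "(s has_real_derivative s') (at t0)" by blast
  have h: "((\<lambda>t. poly (heat (s t) p) (u t)) has_real_derivative
      poly (heat \<theta> (pderiv p)) U * u' + poly (heat \<theta> (pderiv (pderiv p))) U / 2 * s') (at t0)" for p
    using has_derivative_poly_heat[OF u'[unfolded has_field_derivative_def] s'[unfolded has_field_derivative_def], of p]
    unfolding has_field_derivative_def at0
    by (rule has_derivative_eq_rhs) (auto simp: fun_eq_iff algebra_simps)
  have ev_s: "\<forall>\<^sub>F t in nhds t0. 0 < s t" and ev_r: "\<forall>\<^sub>F t in nhds t0. 0 < r t"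
    using DERIV_isCont[OF s'] DERIV_isCont[OF r'] at0 th0 rho
    by (auto simp: isCont_def tendsto_nhds_iff intro!: order_tendstoD(1))
  define q where "q i t = \<nu> * (r t * poly (heat (s t) (monom 1 i)) (u t) - m i t)" for i t
  have ev_q: "\<forall>\<^sub>F t in nhds t0. (\<nu> \<cdot>\<^sub>v bgk_source N (update_vec M j t)) $ i = q i t" if i: "i < ?n" for i
    using ev_s
  proof eventually_elim
    case (elim t)
    have "dim_vec (update_vec M j t) = ?n" using M by (simp add: update_vec_def)
    then show ?case
      using i elim by (simp add: q_def bgk_source_def gauss_moment_eq s_def u_def r_def m_def)
  qed
  define d where "d i = \<nu> * ((r' * poly (heat \<theta> (monom 1 i)) U
      + (poly (heat \<theta> (pderiv (monom 1 i))) U * u' + poly (heat \<theta> (pderiv (pderiv (monom 1 i)))) U / 2 * s') * r t0)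
      - (if i = j then 1 else 0))" for i
  have dq: "(q i has_real_derivative d i) (at t0)" if "i < ?n" for i
    unfolding q_def d_def
    using DERIV_cmult[OF DERIV_diff[OF DERIV_mult[OF r' h[of "monom 1 i"]] dm[OF that, of t0]], of \<nu>]
    unfolding at0 by simp
  have jac: "jacobian ?n (\<lambda>M. \<nu> \<cdot>\<^sub>v bgk_source N M) M $$ (i, j) = d i" if i: "i < ?n" for i
  proof -
    have "((\<lambda>t. (\<nu> \<cdot>\<^sub>v bgk_source N (update_vec M j t)) $ i) has_real_derivative d i) (at t0)"
      using DERIV_cong_ev[OF refl ev_q[OF i] refl] dq[OF i] by blast
    then show ?thesis
      using i j by (simp add: jacobian_def partial_deriv_def t0_def DERIV_imp_deriv)
  qed
  have dg: "degree g = k" using degree_normalized_hermite[OF th0] by (simp add: g_def)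
  \<comment> \<open>The pairing of \<open>g\<close> with the source along the line in direction \<open>j\<close>.\<close>
  define S where "S t = (\<Sum>i<?n. coeff g i * q i t)" for t
  have dS: "(S has_real_derivative (\<Sum>i<?n. coeff g i * d i)) (at t0)"
    unfolding S_def by (intro DERIV_sum DERIV_cmult dq) auto
  have entry: "(hermite_rows N M * jacobian ?n (\<lambda>M. \<nu> \<cdot>\<^sub>v bgk_source N M) M) $$ (k, j) = (\<Sum>i<?n. coeff g i * d i)"
  proof -
    let ?Q = "jacobian ?n (\<lambda>M. \<nu> \<cdot>\<^sub>v bgk_source N M) M"
    have c: "?Q \<in> carrier_mat ?n ?n" by (simp add: jacobian_def)
    have "(hermite_rows N M * ?Q) $$ (k, j) = (\<Sum>i<?n. coeff g i * ?Q $$ (i, j))"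
      unfolding g_def U_def \<theta>_def by (rule rows_mat_mult_index[OF c k j])
    also have "\<dots> = (\<Sum>i<?n. coeff g i * d i)"
      by (intro sum.cong refl arg_cong2[where f = "(*)"] jac) auto
    finally show ?thesis .
  qed
  have val: "(\<Sum>i<?n. coeff g i * d i) = (if k < 3 then 0 else - \<nu> * coeff g j)"
  proof (cases "k < 3")
    case True
    have low: "q i t = 0" if "0 < r t" "i < 3" for i t
    proof -
      consider "i = 0" | "i = Suc 0" | "i = 2" using \<open>i < 3\<close> by linarith
      then show ?thesis
        using that(1) by cases (auto simp: q_def poly_heat_monom_low rm um sm field_simps power2_eq_square)
    qed
    have "S t = 0" if "0 < r t" for t
      unfolding S_def
    proof (intro sum.neutral ballI)
      fix i
      show "coeff g i * q i t = 0"
        using low[OF that, of i] True dg coeff_eq_0[of g i] by (cases "i < 3") auto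
    qed
    then have "\<forall>\<^sub>F t in nhds t0. S t = 0" using ev_r by (auto elim: eventually_mono)
    then have "(S has_real_derivative 0) (at t0)"
      using DERIV_cong_ev[of t0 t0 S "\<lambda>_. 0" 0 0] by simp
    then show ?thesis using DERIV_unique[OF dS] True by simp
  next
    case False
    have eq: "S = (\<lambda>t. \<nu> * (r t * poly (heat (s t) g) (u t) - (\<Sum>i<?n. coeff g i * m i t)))"
    proof
      fix t
      have "poly (heat (s t) g) (u t) = (\<Sum>i<?n. coeff g i * poly (heat (s t) (monom 1 i)) (u t))"
        by (rule sum_coeff_heat_monom[symmetric]) (use k dg in simp)
      then show "S t = \<nu> * (r t * poly (heat (s t) g) (u t) - (\<Sum>i<?n. coeff g i * m i t))"
        unfolding S_def q_def
        by (simp add: sum_distrib_left sum_subtractf[symmetric] algebra_simps del: sum.lessThan_Suc)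
    qed
    have g: "heat \<theta> g = Polynomial.smult (1 / hermite_norm \<theta> k) ([:- U, 1:] ^ k)"
      by (simp add: g_def normalized_hermite_def heat_smult heat_hermite)
    have z: "poly (heat \<theta> g) U = 0" "poly (heat \<theta> (pderiv g)) U = 0" "poly (heat \<theta> (pderiv (pderiv g))) U = 0"
      unfolding heat_pderiv g pderiv_smult using False poly_pderiv_power_centre[of k U] by (auto simp: power_0_left)
    have "((\<lambda>t. \<Sum>i<?n. coeff g i * m i t) has_real_derivative (\<Sum>i<?n. coeff g i * (if i = j then 1 else 0))) (at t0)"
      by (intro DERIV_sum DERIV_cmult dm) auto
    also have "(\<Sum>i<?n. coeff g i * (if i = j then 1 else 0)) = coeff g j"
      using j by (simp add: if_distrib cong: if_cong del: sum.lessThan_Suc)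
    finally have "(S has_real_derivative \<nu> * ((r' * poly (heat (s t0) g) (u t0)
        + (poly (heat \<theta> (pderiv g)) U * u' + poly (heat \<theta> (pderiv (pderiv g))) U / 2 * s') * r t0) - coeff g j)) (at t0)"
      unfolding eq by (intro DERIV_cmult DERIV_diff DERIV_mult r' h)
    then have "(S has_real_derivative - \<nu> * coeff g j) (at t0)"
      unfolding at0 z by simp
    then show ?thesis using DERIV_unique[OF dS] False by simp
  qed
  show ?thesis using trans[OF entry val] unfolding g_def U_def \<theta>_def .
qed


section \<open>Equilibria and structural stability\<close>

lemma moment_map_index:
  assumes "0 < node_var N W" "j < 2 * N + 1"
  shows "moment_map N W $ j = mom N (\<lambda>k. W $ k) (monom 1 j)"
  using assms by (simp add: moment_map_def eqmom_moment_eq)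

lemma moment_map_carrier [simp]: "moment_map N W \<in> carrier_vec (2 * N + 1)"
  by (simp add: moment_map_def)

text \<open>The last equation is the decomposition of the total variance into the variance of the components and the
variance of the nodes.\<close>

lemma macro_moment_map:
  assumes N: "1 \<le> N" and pos: "\<forall>i<N. 0 < weight W i" and s: "0 < node_var N W"
  shows "macro_rho (moment_map N W) = (\<Sum>i<N. weight W i)" "0 < macro_rho (moment_map N W)"
    and "macro_rho (moment_map N W) * macro_U (moment_map N W) = (\<Sum>i<N. weight W i * node W i)"
    and "macro_rho (moment_map N W) * (macro_theta (moment_map N W) - node_var N W)
      = (\<Sum>i<N. weight W i * (node W i - macro_U (moment_map N W))\<^sup>2)"
proof -
  let ?M = "moment_map N W"
  show rho: "macro_rho ?M = (\<Sum>i<N. weight W i)"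
    using moment_map_index[OF s, of 0] by (simp add: macro_rho_def mom_def poly_heat_monom_low(1) weight_def)
  show rho_pos: "0 < macro_rho ?M"
    unfolding rho by (rule sum_pos) (use N pos in \<open>auto simp: lessThan_empty_iff\<close>)
  have m1: "?M $ 1 = (\<Sum>i<N. weight W i * node W i)"
    using moment_map_index[OF s, of 1] N by (simp add: mom_def poly_heat_monom_low(2) weight_def node_def)
  then show U: "macro_rho ?M * macro_U ?M = (\<Sum>i<N. weight W i * node W i)"
    using rho_pos by (simp add: macro_U_def macro_rho_def)
  have m2: "?M $ 2 = (\<Sum>i<N. weight W i * ((node W i)\<^sup>2 + node_var N W))"
    using moment_map_index[OF s, of 2] N by (simp add: mom_def poly_heat_monom_low(3) weight_def node_def node_var_def)
  have "macro_rho ?M * macro_theta ?M = ?M $ 2 - macro_rho ?M * (macro_U ?M)\<^sup>2"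
    using rho_pos by (simp add: macro_theta_def macro_rho_def right_diff_distrib)
  then have "macro_rho ?M * (macro_theta ?M - node_var N W)
     = (\<Sum>i<N. weight W i * (node W i)\<^sup>2) - macro_rho ?M * (macro_U ?M)\<^sup>2"
    unfolding right_diff_distrib m2 rho by (simp add: distrib_left sum.distrib sum_distrib_right)
  also have "\<dots> = (\<Sum>i<N. weight W i * (node W i)\<^sup>2) - 2 * macro_U ?M * (macro_rho ?M * macro_U ?M) + macro_rho ?M * (macro_U ?M)\<^sup>2"
    by (simp add: power2_eq_square algebra_simps)
  also have "\<dots> = (\<Sum>i<N. weight W i * (node W i - macro_U ?M)\<^sup>2)"
    unfolding U unfolding rho
    by (simp add: power2_diff algebra_simps sum.distrib sum_subtractf sum_distrib_left)
      (simp add: sum_distrib_right)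
  finally show "macro_rho ?M * (macro_theta ?M - node_var N W) = (\<Sum>i<N. weight W i * (node W i - macro_U ?M)\<^sup>2)" .
qed

lemma Omega_eq_equilibrium:
  assumes W: "W \<in> Omega_eq N" and N: "1 \<le> N"
  shows "0 < macro_rho (moment_map N W)" "0 < macro_theta (moment_map N W)" "bgk_source N (moment_map N W) = 0\<^sub>v (2 * N + 1)"
proof -
  let ?M = "moment_map N W"
  have pos: "\<forall>i<N. 0 < weight W i" and s: "0 < node_var N W"
    using W by (simp_all add: Omega_eq_def)
  have "0 < N" using N by simp
  then have n: "node W i = node W 0" if "i < N" for i
    using W that unfolding Omega_eq_def by blast
  note mac = macro_moment_map[OF N pos s]
  show rho: "0 < macro_rho ?M" by (rule mac(2))
  have "macro_rho ?M * macro_U ?M = macro_rho ?M * node W 0"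
    unfolding mac(3) unfolding mac(1) sum_distrib_right
    by (intro sum.cong refl arg_cong2[where f = "(*)"] n) auto
  then have U: "macro_U ?M = node W 0" using rho by simp
  have "macro_rho ?M * (macro_theta ?M - node_var N W) = 0"
    unfolding mac(4) U
  proof (intro sum.neutral ballI)
    fix i assume "i \<in> {..<N}"
    then show "weight W i * (node W i - node W 0)\<^sup>2 = 0" using n[of i] by simp
  qed
  then have t: "macro_theta ?M = node_var N W" using rho by simp
  with s show "0 < macro_theta ?M" by simp
  show "bgk_source N ?M = 0\<^sub>v (2 * N + 1)"
  proof (rule eq_vecI)
    fix j assume "j < dim_vec (0\<^sub>v (2 * N + 1))"
    then have j: "j < 2 * N + 1" by simp
    have "?M $ j = (\<Sum>i<N. weight W i * poly (heat (node_var N W) (monom 1 j)) (node W i))"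
      unfolding moment_map_index[OF s j] by (simp add: mom_def weight_def node_def node_var_def)
    also have "\<dots> = macro_rho ?M * poly (heat (node_var N W) (monom 1 j)) (node W 0)"
      unfolding mac(1) sum_distrib_right
      by (intro sum.cong refl arg_cong2[where f = "(*)"] arg_cong2[where f = poly] n) auto
    finally show "bgk_source N ?M $ j = 0\<^sub>v (2 * N + 1) $ j"
      using j s carrier_vecD[OF moment_map_carrier[of N W]] by (simp add: bgk_source_def U t gauss_moment_eq)
  qed (simp add: bgk_source_def moment_map_def)
qed

text \<open>The spread of the nodes makes \<open>\<theta>\<close> larger than the common variance \<open>s\<close> of the components. The expectation of
\<open>heat (- s) q\<close>, with \<open>q\<close> the squared node polynomial, is zero under the mixture, but under the Maxwellian
it is \<open>\<rho>\<close> times the value of \<open>heat (\<theta> - s) q\<close> at \<open>U\<close>, which is positive.\<close>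

lemma Omega_open_not_equilibrium:
  assumes W: "W \<in> Omega_open N" and N: "2 \<le> N"
  shows "bgk_source N (moment_map N W) \<noteq> 0\<^sub>v (2 * N + 1)"
proof
  let ?M = "moment_map N W" and ?c = "\<lambda>k. W $ k"
  assume eq: "bgk_source N ?M = 0\<^sub>v (2 * N + 1)"
  have pos: "\<forall>i<N. 0 < weight W i" and s: "0 < node_var N W"
    and dist: "\<And>i j. i < N \<Longrightarrow> j < N \<Longrightarrow> i \<noteq> j \<Longrightarrow> node W i \<noteq> node W j"
    using W by (auto simp: Omega_open_def)
  have N1: "1 \<le> N" using N by simp
  note mac = macro_moment_map[OF N1 pos s]
  let ?s = "node_var N W" and ?t = "macro_theta ?M" and ?U = "macro_U ?M"
  have "0 < N" "1 < N" using N by auto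
  then have "\<exists>i<N. node W i \<noteq> ?U" using dist[of 0 1] by (metis zero_neq_one)
  then obtain i where i: "i < N" "node W i \<noteq> ?U" by blast
  have "0 < (\<Sum>i<N. weight W i * (node W i - ?U)\<^sup>2)"
    by (rule sum_pos2[of _ i]) (use i pos in \<open>auto intro!: mult_nonneg_nonneg zero_le_power2 intro: less_imp_le\<close>)
  then have "0 < macro_rho ?M * (?t - ?s)" unfolding mac(4) .
  then have ts: "?s < ?t" using zero_less_mult_pos[of "macro_rho ?M" "?t - ?s"] mac(2) by simp
  then have t: "0 < ?t" using s by simp
  have gauss: "mom N ?c (monom 1 j) = macro_rho ?M * poly (heat ?t (monom 1 j)) ?U" if j: "j < 2 * N + 1" for j
  proof -
    have "bgk_source N ?M $ j = 0" using eq j by simp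
    then show ?thesis
      using j t moment_map_index[OF s j] by (simp add: bgk_source_def gauss_moment_eq moment_map_def)
  qed
  have all: "mom N ?c p = macro_rho ?M * poly (heat ?t p) ?U" if "degree p < 2 * N + 1" for p
  proof -
    have "mom N ?c p = (\<Sum>j<2 * N + 1. coeff p j * mom N ?c (monom 1 j))"
      by (subst poly_as_sum_monom[OF that], rule mom_sum)
    also have "\<dots> = macro_rho ?M * (\<Sum>j<2 * N + 1. coeff p j * poly (heat ?t (monom 1 j)) ?U)"
      unfolding sum_distrib_left by (intro sum.cong refl) (use gauss in \<open>simp add: mult_ac\<close>)
    finally show ?thesis unfolding sum_coeff_heat_monom[OF that] .
  qed
  let ?q = "(node_poly N ?c)\<^sup>2"
  have "mom N ?c (heat (- ?s) ?q) = 0"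
    unfolding mom_heat by (intro sum.neutral) (auto simp: poly_node_poly[simplified] node_var_def)
  moreover have "mom N ?c (heat (- ?s) ?q) = macro_rho ?M * poly (heat (?t - ?s) ?q) ?U"
    by (subst all) (simp_all add: degree_node_poly_sq heat_heat)
  moreover have "0 < poly (heat (?t - ?s) ?q) ?U"
    by (rule heat_pos) (use ts node_poly_nz[of N ?c] in auto)
  ultimately show False using mac(2) by simp
qed

lemma Omega_eq_nonempty: "1 \<le> N \<Longrightarrow> Omega_eq N \<noteq> {}"
proof -
  have "vec (2 * N + 1) (\<lambda>k. if k = 2 * N \<or> even k then 1 else 0) \<in> Omega_eq N"
    by (auto simp: Omega_eq_def weight_def node_def node_var_def)
  then show ?thesis by blast
qed

lemma lower_block_carrier [simp]: "T \<in> carrier_mat r r \<Longrightarrow> r \<le> n \<Longrightarrow> lower_block n r T \<in> carrier_mat n n"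
  unfolding lower_block_def by (auto intro: four_block_carrier_mat)

lemma lower_block_smult_one_mult:
  assumes "L \<in> carrier_mat n n" "r \<le> n" "k < n" "j < n"
  shows "(lower_block n r (a \<cdot>\<^sub>m 1\<^sub>m r) * L) $$ (k, j) = (if k < n - r then 0 else a * L $$ (k, j))"
proof -
  have c: "lower_block n r (a \<cdot>\<^sub>m 1\<^sub>m r) \<in> carrier_mat n n" using assms(2) by simp
  have e: "lower_block n r (a \<cdot>\<^sub>m 1\<^sub>m r) $$ (k, i) = (if k < n - r then 0 else if i = k then a else 0)" if "i < n" for i
    using assms that by (auto simp: lower_block_def)
  have "(lower_block n r (a \<cdot>\<^sub>m 1\<^sub>m r) * L) $$ (k, j) = (\<Sum>i<n. lower_block n r (a \<cdot>\<^sub>m 1\<^sub>m r) $$ (k, i) * L $$ (i, j))"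
    using assms carrier_matD[OF c] by (simp add: scalar_prod_def lessThan_atLeast0)
  also have "\<dots> = (\<Sum>i<n. if i = k then (if k < n - r then 0 else a * L $$ (k, j)) else 0)"
    by (intro sum.cong refl) (auto simp: e)
  finally show ?thesis using assms by simp
qed

lemma hermite_rows_diagonalize_jacobian:
  assumes W: "W \<in> Omega_eq N" and N: "1 \<le> N" and "M = moment_map N W"
  shows "hermite_rows N M * jacobian (2 * N + 1) (\<lambda>M. \<nu> \<cdot>\<^sub>v bgk_source N M) M
       = lower_block (2 * N + 1) (2 * N - 2) (- \<nu> \<cdot>\<^sub>m 1\<^sub>m (2 * N - 2)) * hermite_rows N M"
proof (rule eq_matI)
  let ?R = "lower_block (2 * N + 1) (2 * N - 2) (- \<nu> \<cdot>\<^sub>m 1\<^sub>m (2 * N - 2)) * hermite_rows N M"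
  have c: "lower_block (2 * N + 1) (2 * N - 2) (- \<nu> \<cdot>\<^sub>m 1\<^sub>m (2 * N - 2)) \<in> carrier_mat (2 * N + 1) (2 * N + 1)"
    by (rule lower_block_carrier) auto
  fix k j assume "k < dim_row ?R" "j < dim_col ?R"
  then have k: "k < 2 * N + 1" and j: "j < 2 * N + 1" using carrier_matD[OF c] by (auto simp: rows_mat_def)
  have "?R $$ (k, j) = (if k < 3 then 0 else - \<nu> * hermite_rows N M $$ (k, j))"
    using lower_block_smult_one_mult[of "hermite_rows N M" "2 * N + 1" "2 * N - 2" k j "- \<nu>"] k j N
    by (auto simp: numeral_3_eq_3)
  moreover have "M \<in> carrier_vec (2 * N + 1)" unfolding assms(3) by (rule moment_map_carrier)
  from hermite_rows_mult_jacobian[OF this N _ _ k j, of \<nu>]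
  have "(hermite_rows N M * jacobian (2 * N + 1) (\<lambda>M. \<nu> \<cdot>\<^sub>v bgk_source N M) M) $$ (k, j)
      = (if k < 3 then 0 else - \<nu> * coeff (normalized_hermite (macro_U M) (macro_theta M) k) j)"
    using Omega_eq_equilibrium[OF W N] assms(3) by blast
  moreover have "hermite_rows N M $$ (k, j) = coeff (normalized_hermite (macro_U M) (macro_theta M) k) j"
    using k j by (simp add: rows_mat_def)
  ultimately show "(hermite_rows N M * jacobian (2 * N + 1) (\<lambda>M. \<nu> \<cdot>\<^sub>v bgk_source N M) M) $$ (k, j) = ?R $$ (k, j)"
    by (simp only:)
next
  have c: "lower_block (2 * N + 1) (2 * N - 2) (- \<nu> \<cdot>\<^sub>m 1\<^sub>m (2 * N - 2)) \<in> carrier_mat (2 * N + 1) (2 * N + 1)"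
    by (rule lower_block_carrier) auto
  show "dim_row (hermite_rows N M * jacobian (2 * N + 1) (\<lambda>M. \<nu> \<cdot>\<^sub>v bgk_source N M) M)
      = dim_row (lower_block (2 * N + 1) (2 * N - 2) (- \<nu> \<cdot>\<^sub>m 1\<^sub>m (2 * N - 2)) * hermite_rows N M)"
    "dim_col (hermite_rows N M * jacobian (2 * N + 1) (\<lambda>M. \<nu> \<cdot>\<^sub>v bgk_source N M) M)
      = dim_col (lower_block (2 * N + 1) (2 * N - 2) (- \<nu> \<cdot>\<^sub>m 1\<^sub>m (2 * N - 2)) * hermite_rows N M)"
    using carrier_matD[OF c] by (simp_all add: jacobian_def rows_mat_def)
qed

text \<open>With \<open>E = lower_block n r 1\<close>, both summands on the left equal \<open>- \<nu> L\<^sup>T E L\<close>; the factor \<open>sqrt (2 \<nu>)\<close> in \<open>P\<close> is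
chosen to match their sum.\<close>

lemma dissipation_identity:
  assumes L: "L \<in> carrier_mat n n" and Q: "Q \<in> carrier_mat n n" and r: "r \<le> n" and \<nu>: "0 \<le> \<nu>"
    and LQ: "L * Q = lower_block n r (- \<nu> \<cdot>\<^sub>m 1\<^sub>m r) * L"
  defines "P \<equiv> sqrt (2 * \<nu>) \<cdot>\<^sub>m L"
  shows "P * Q = lower_block n r (- \<nu> \<cdot>\<^sub>m 1\<^sub>m r) * P"
    and "transpose_mat L * L * Q + transpose_mat Q * (transpose_mat L * L)
       = - (transpose_mat P * lower_block n r (1\<^sub>m r) * P)"
proof -
  let ?E = "lower_block n r (1\<^sub>m r)" and ?D = "lower_block n r (- \<nu> \<cdot>\<^sub>m 1\<^sub>m r)"
  have E: "?E \<in> carrier_mat n n" and D: "?D \<in> carrier_mat n n"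
    using r by (auto intro!: lower_block_carrier)
  have DE: "?D = - \<nu> \<cdot>\<^sub>m ?E" using r by (intro eq_matI) (auto simp: lower_block_def)
  have Et: "transpose_mat ?E = ?E" using r by (intro eq_matI) (auto simp: lower_block_def)
  have Lt: "transpose_mat L \<in> carrier_mat n n" using L by simp
  have tsm: "transpose_mat (a \<cdot>\<^sub>m X) = a \<cdot>\<^sub>m transpose_mat X" for a :: real and X
    by (intro eq_matI) auto
  show "P * Q = ?D * P"
    unfolding P_def mult_smult_assoc_mat[OF L Q] mult_smult_distrib[OF D L] LQ ..
  define X where "X = transpose_mat L * (?E * L)"
  have X: "X \<in> carrier_mat n n" using L E by (simp add: X_def)
  have LLQ: "transpose_mat L * L * Q = - \<nu> \<cdot>\<^sub>m X"
  proof -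
    have "transpose_mat L * L * Q = transpose_mat L * (L * Q)" by (rule assoc_mult_mat[OF Lt L Q])
    also have "L * Q = - \<nu> \<cdot>\<^sub>m (?E * L)" unfolding LQ DE by (rule mult_smult_assoc_mat[OF E L])
    also have "transpose_mat L * (- \<nu> \<cdot>\<^sub>m (?E * L)) = - \<nu> \<cdot>\<^sub>m X"
      unfolding X_def by (rule mult_smult_distrib[OF Lt]) (use E L in auto)
    finally show ?thesis .
  qed
  have Xt: "transpose_mat X = X"
  proof -
    have "transpose_mat X = transpose_mat (?E * L) * transpose_mat (transpose_mat L)"
      unfolding X_def by (rule transpose_mult[OF Lt]) (use E L in auto)
    also have "transpose_mat (?E * L) = transpose_mat L * ?E"
      using transpose_mult[OF E L] Et by simp
    finally show ?thesis unfolding X_def using assoc_mult_mat[OF Lt E L] by simp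
  qed
  have QLL: "transpose_mat Q * (transpose_mat L * L) = - \<nu> \<cdot>\<^sub>m X"
  proof -
    have LL: "transpose_mat L * L \<in> carrier_mat n n" using L by simp
    have "transpose_mat (transpose_mat L * L * Q) = transpose_mat Q * transpose_mat (transpose_mat L * L)"
      by (rule transpose_mult[OF LL Q])
    also have "transpose_mat (transpose_mat L * L) = transpose_mat L * L"
      using transpose_mult[OF Lt L] by simp
    finally show ?thesis unfolding LLQ using Xt by (simp add: tsm)
  qed
  have PEP: "transpose_mat P * ?E * P = (2 * \<nu>) \<cdot>\<^sub>m X"
  proof -
    have "transpose_mat P * ?E * P = (sqrt (2 * \<nu>) \<cdot>\<^sub>m transpose_mat L) * ?E * (sqrt (2 * \<nu>) \<cdot>\<^sub>m L)"
      by (simp add: P_def tsm)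
    also have "\<dots> = sqrt (2 * \<nu>) \<cdot>\<^sub>m (sqrt (2 * \<nu>) \<cdot>\<^sub>m (transpose_mat L * ?E * L))"
      unfolding mult_smult_assoc_mat[OF Lt E]
        mult_smult_assoc_mat[OF mult_carrier_mat[OF Lt E] smult_carrier_mat[OF L]]
        mult_smult_distrib[OF mult_carrier_mat[OF Lt E] L] ..
    also have "transpose_mat L * ?E * L = X" unfolding X_def by (rule assoc_mult_mat[OF Lt E L])
    finally show ?thesis
      using \<nu> X by (intro eq_matI) auto
  qed
  show "transpose_mat L * L * Q + transpose_mat Q * (transpose_mat L * L) = - (transpose_mat P * ?E * P)"
    unfolding LLQ QLL PEP using X by (intro eq_matI) auto
qed

lemma image_Omega_cases:
  assumes "M \<in> moment_map N ` Omega N" "M \<notin> moment_map N ` Omega_open N"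
  obtains W where "W \<in> Omega_eq N" "M = moment_map N W"
  using assms by (auto simp: Omega_def)

text \<open>Away from equilibrium any symmetrizer will do; only at equilibrium must it fit the collision term.\<close>

definition symmetrizer :: "nat \<Rightarrow> real vec \<Rightarrow> real mat" where
  "symmetrizer N M = (if M \<in> moment_map N ` Omega_open N
     then SOME B. sym_pos_def (2 * N + 1) B \<and> B * coeff_matrix N M = transpose_mat (coeff_matrix N M) * B
     else transpose_mat (hermite_rows N M) * hermite_rows N M)"

lemma symmetrizer_symmetrizes:
  assumes "M \<in> moment_map N ` Omega N" and N: "1 \<le> N"
  shows "sym_pos_def (2 * N + 1) (symmetrizer N M) \<and>
    symmetrizer N M * coeff_matrix N M = transpose_mat (coeff_matrix N M) * symmetrizer N M"
proof (cases "M \<in> moment_map N ` Omega_open N")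
  case True
  then obtain W where W: "W \<in> Omega_open N" "M = moment_map N W" by blast
  from someI_ex[OF coeff_matrix_symmetrizer_open[OF W(1) N]] True show ?thesis
    unfolding W(2)[symmetric] symmetrizer_def by simp
next
  case False
  then obtain W where W: "W \<in> Omega_eq N" "M = moment_map N W"
    using assms(1) image_Omega_cases by blast
  have "0 < macro_theta M" using Omega_eq_equilibrium(2)[OF W(1) N] W(2) by simp
  from coeff_matrix_symmetrizer_eq[OF False this] False show ?thesis by (simp add: symmetrizer_def)
qed

lemma smult_bgk_zero_iff:
  "0 < \<nu> \<Longrightarrow> (\<nu> \<cdot>\<^sub>v bgk_source N M = 0\<^sub>v n) = (bgk_source N M = 0\<^sub>v n)"
proof -
  assume "0 < \<nu>"
  then have "bgk_source N M = (1 / \<nu>) \<cdot>\<^sub>v (\<nu> \<cdot>\<^sub>v bgk_source N M)"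
    by (intro eq_vecI) auto
  moreover have "a \<cdot>\<^sub>v 0\<^sub>v n = 0\<^sub>v n" for a :: real by (intro eq_vecI) auto
  ultimately show ?thesis by metis
qed

lemma invertible_mat_of_det:
  assumes A: "A \<in> carrier_mat n n" and "det (A :: real mat) \<noteq> 0"
  shows "invertible_mat A"
proof -
  obtain B where "B \<in> carrier_mat n n" "B * A = 1\<^sub>m n" "A * B = 1\<^sub>m n"
    using det_non_zero_imp_unit[OF A assms(2), unfolded Units_def ring_mat_def] by auto
  then show ?thesis
    using A unfolding invertible_mat_def inverts_mat_def by auto
qed

text \<open>For \<open>N = 1\<close> the two parameter domains coincide; otherwise mixtures with distinct nodes are excluded.\<close>

lemma equilibria_eqmom:
  assumes N: "1 \<le> N" and nu: "0 < \<nu>"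
  shows "equilibria (2 * N + 1) (moment_map N ` Omega N) (\<lambda>M. \<nu> \<cdot>\<^sub>v bgk_source N M) = moment_map N ` Omega_eq N"
proof (intro equalityI subsetI)
  fix M assume "M \<in> moment_map N ` Omega_eq N"
  then show "M \<in> equilibria (2 * N + 1) (moment_map N ` Omega N) (\<lambda>M. \<nu> \<cdot>\<^sub>v bgk_source N M)"
    using Omega_eq_equilibrium(3)[OF _ N] smult_bgk_zero_iff[OF nu, of N _ "2 * N + 1"]
    unfolding equilibria_def Omega_def by blast
next
  fix M assume M: "M \<in> equilibria (2 * N + 1) (moment_map N ` Omega N) (\<lambda>M. \<nu> \<cdot>\<^sub>v bgk_source N M)"
  then have Q: "bgk_source N M = 0\<^sub>v (2 * N + 1)" and "M \<in> moment_map N ` Omega N"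
    using smult_bgk_zero_iff[OF nu] unfolding equilibria_def by blast+
  then obtain W where W: "W \<in> Omega N" "M = moment_map N W" by blast
  have "W \<in> Omega_eq N"
  proof (cases "N = 1")
    case True
    then show ?thesis using W(1) by (auto simp: Omega_def Omega_open_def Omega_eq_def)
  next
    case False
    then show ?thesis using W Q N Omega_open_not_equilibrium[of W N] by (auto simp: Omega_def)
  qed
  then show "M \<in> moment_map N ` Omega_eq N" using W(2) by blast
qed

lemma eq_image_not_open:
  assumes "W \<in> Omega_eq N" "2 \<le> N"
  shows "moment_map N W \<notin> moment_map N ` Omega_open N"
  using Omega_eq_equilibrium(3)[OF assms(1)] Omega_open_not_equilibrium[OF _ assms(2)] assms(2) by force

text \<open>The rank \<open>2N - 2\<close> counts the moments that are not conserved; it is zero for \<open>N = 1\<close>.\<close>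

lemma eqmom_stable_rank:
  assumes N: "1 \<le> N" and nu: "0 < \<nu>"
  shows "structurally_stable_rank (2 * N + 1) (2 * N - 2) (moment_map N ` Omega N)
             (coeff_matrix N) (\<lambda>M. \<nu> \<cdot>\<^sub>v bgk_source N M)"
proof -
  let ?n = "2 * N + 1" and ?r = "2 * N - 2" and ?Q = "\<lambda>M. \<nu> \<cdot>\<^sub>v bgk_source N M"
  let ?P = "\<lambda>M. sqrt (2 * \<nu>) \<cdot>\<^sub>m hermite_rows N M" and ?T = "- \<nu> \<cdot>\<^sub>m 1\<^sub>m ?r"
  have r: "?r \<le> ?n" by simp
  have Qc: "jacobian ?n ?Q M \<in> carrier_mat ?n ?n" for M by (simp add: jacobian_def)
  have eq: "?P M \<in> carrier_mat ?n ?n \<and> invertible_mat (?P M) \<and> ?T \<in> carrier_mat ?r ?r \<and> invertible_mat ?T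
      \<and> ?P M * jacobian ?n ?Q M = lower_block ?n ?r ?T * ?P M"
    and diss: "loewner_le ?n (symmetrizer N M * jacobian ?n ?Q M + transpose_mat (jacobian ?n ?Q M) * symmetrizer N M)
             (- (transpose_mat (?P M) * lower_block ?n ?r (1\<^sub>m ?r) * ?P M))"
    if M: "M \<in> moment_map N ` Omega_eq N" for M
  proof -
    obtain W where W: "W \<in> Omega_eq N" "M = moment_map N W" using M by blast
    have th: "0 < macro_theta M" using Omega_eq_equilibrium(2)[OF W(1) N] W(2) by simp
    have LQ: "hermite_rows N M * jacobian ?n ?Q M = lower_block ?n ?r ?T * hermite_rows N M"
      by (rule hermite_rows_diagonalize_jacobian[OF W(1) N W(2)])
    have nu0: "0 \<le> \<nu>" using nu by simp
    note D = dissipation_identity[OF rows_mat_carrier Qc r nu0 LQ]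
    have dP: "det (?P M) \<noteq> 0" using det_hermite_rows_nz[OF th] nu by (simp add: det_smult)
    have dT: "det ?T \<noteq> 0" using nu by (simp add: det_smult)
    show "?P M \<in> carrier_mat ?n ?n \<and> invertible_mat (?P M) \<and> ?T \<in> carrier_mat ?r ?r \<and> invertible_mat ?T
      \<and> ?P M * jacobian ?n ?Q M = lower_block ?n ?r ?T * ?P M"
    proof (intro conjI)
      show Pc: "?P M \<in> carrier_mat ?n ?n" by (rule smult_carrier_mat[OF rows_mat_carrier])
      show "invertible_mat (?P M)" by (rule invertible_mat_of_det[OF Pc dP])
      show Tc: "?T \<in> carrier_mat ?r ?r" by (rule smult_carrier_mat[OF one_carrier_mat])
      show "invertible_mat ?T" by (rule invertible_mat_of_det[OF Tc dT])
    qed (rule D(1))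
    show "loewner_le ?n (symmetrizer N M * jacobian ?n ?Q M + transpose_mat (jacobian ?n ?Q M) * symmetrizer N M)
             (- (transpose_mat (?P M) * lower_block ?n ?r (1\<^sub>m ?r) * ?P M))"
    \<comment> \<open>For \<open>N = 1\<close> the symmetrizer is an unspecified one, but then the rank is zero and both sides vanish.\<close>
    proof (cases "N = 1")
      case False
      then have "symmetrizer N M = transpose_mat (hermite_rows N M) * hermite_rows N M"
        using eq_image_not_open[OF W(1)] N W(2) by (simp add: symmetrizer_def)
      then show ?thesis unfolding loewner_le_def using D(2) by simp
    next
      case True
      have z: "lower_block ?n ?r T * X = 0\<^sub>m ?n ?n" if "X \<in> carrier_mat ?n ?n" "T \<in> carrier_mat ?r ?r" for T X :: "real mat"
      proof -
        have "lower_block ?n ?r T = 0\<^sub>m ?n ?n"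
          using True that by (intro eq_matI) (auto simp: lower_block_def)
        then show ?thesis using that(1) by simp
      qed
      obtain B where B: "B \<in> carrier_mat ?n ?n" "B * hermite_rows N M = 1\<^sub>m ?n"
        using det_non_zero_imp_unit[OF rows_mat_carrier det_hermite_rows_nz[OF th], unfolded Units_def ring_mat_def]
        by auto
      have "hermite_rows N M * jacobian ?n ?Q M = 0\<^sub>m ?n ?n" unfolding LQ by (rule z) auto
      then have "B * (hermite_rows N M * jacobian ?n ?Q M) = 0\<^sub>m ?n ?n" using B by simp
      then have J: "jacobian ?n ?Q M = 0\<^sub>m ?n ?n"
        using assoc_mult_mat[OF B(1) rows_mat_carrier Qc, of "normalized_hermite (macro_U M) (macro_theta M)" M] B(2) Qc[of M]
        by simp
      have A0: "symmetrizer N M \<in> carrier_mat ?n ?n"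
        using symmetrizer_symmetrizes[of M N] M N unfolding sym_pos_def_def Omega_def by blast
      have lhs: "symmetrizer N M * jacobian ?n ?Q M + transpose_mat (jacobian ?n ?Q M) * symmetrizer N M = 0\<^sub>m ?n ?n"
        unfolding J using A0 by (simp add: zero_transpose_mat)
      have Pc: "?P M \<in> carrier_mat ?n ?n" by (rule smult_carrier_mat[OF rows_mat_carrier])
      have Pt: "transpose_mat (?P M) \<in> carrier_mat ?n ?n"
        by (rule carrier_matI) (simp_all add: rows_mat_def)
      have Ec: "lower_block ?n ?r (1\<^sub>m ?r) \<in> carrier_mat ?n ?n" by (rule lower_block_carrier) auto
      have "transpose_mat (?P M) * lower_block ?n ?r (1\<^sub>m ?r) * ?P M
          = transpose_mat (?P M) * (lower_block ?n ?r (1\<^sub>m ?r) * ?P M)"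
        by (rule assoc_mult_mat[OF Pt Ec Pc])
      also have "\<dots> = 0\<^sub>m ?n ?n" unfolding z[OF Pc one_carrier_mat] by (rule right_mult_zero_mat[OF Pt])
      finally have rhs: "- (transpose_mat (?P M) * lower_block ?n ?r (1\<^sub>m ?r) * ?P M) = 0\<^sub>m ?n ?n"
        by (intro eq_matI) auto
      show ?thesis unfolding loewner_le_def lhs rhs by simp
    qed
  qed
  have c1: "\<forall>M \<in> moment_map N ` Omega_eq N.
      ?P M \<in> carrier_mat ?n ?n \<and> invertible_mat (?P M) \<and> ?T \<in> carrier_mat ?r ?r \<and> invertible_mat ?T
      \<and> ?P M * jacobian ?n ?Q M = lower_block ?n ?r ?T * ?P M"
    by (rule ballI) (rule eq)
  have c2: "\<forall>M \<in> moment_map N ` Omega N. sym_pos_def ?n (symmetrizer N M) \<and>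
      symmetrizer N M * coeff_matrix N M = transpose_mat (coeff_matrix N M) * symmetrizer N M"
    by (rule ballI) (rule symmetrizer_symmetrizes[OF _ N])
  have c3: "\<forall>M \<in> moment_map N ` Omega_eq N.
      loewner_le ?n (symmetrizer N M * jacobian ?n ?Q M + transpose_mat (jacobian ?n ?Q M) * symmetrizer N M)
        (- (transpose_mat (?P M) * lower_block ?n ?r (1\<^sub>m ?r) * ?P M))"
    by (rule ballI) (rule diss)
  have ne: "moment_map N ` Omega_eq N \<noteq> {}" using Omega_eq_nonempty[OF N] by blast
  show ?thesis
    unfolding structurally_stable_rank_def equilibria_eqmom[OF N nu]
    by (rule conjI[OF r conjI[OF ne]], rule exI[of _ ?P], rule exI[of _ "\<lambda>_. ?T"], rule exI[of _ "symmetrizer N"])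
      (rule conjI[OF c1 conjI[OF c2 c3]])
qed

theorem theorem2p2:
  fixes N :: nat and \<nu> :: real
  assumes "1 \<le> N" and "0 < \<nu>"
  shows "(2 \<le> N \<longrightarrow> structurally_stable (2 * N + 1) (moment_map N ` Omega N)
             (coeff_matrix N) (\<lambda>M. \<nu> \<cdot>\<^sub>v bgk_source N M)) \<and>
         (N = 1 \<longrightarrow> structurally_stable_rank (2 * N + 1) 0 (moment_map N ` Omega N)
             (coeff_matrix N) (\<lambda>M. \<nu> \<cdot>\<^sub>v bgk_source N M))"
proof (intro conjI impI)
  assume "2 \<le> N"
  then have "0 < 2 * N - 2" by simp
  then show "structurally_stable (2 * N + 1) (moment_map N ` Omega N)
             (coeff_matrix N) (\<lambda>M. \<nu> \<cdot>\<^sub>v bgk_source N M)"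
    using eqmom_stable_rank[OF assms] unfolding structurally_stable_def by blast
next
  assume "N = 1"
  then show "structurally_stable_rank (2 * N + 1) 0 (moment_map N ` Omega N)
             (coeff_matrix N) (\<lambda>M. \<nu> \<cdot>\<^sub>v bgk_source N M)"
    using eqmom_stable_rank[OF assms] by simp
qed

end
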